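(* For the problem $\textsf{LeafColoring}$ (on graphs of maximum degree at most a fixed constant $\Delta\ge 3$): \[ \text{R-DIST}(\textsf{LeafColoring}) = \Theta(\log n),\quad \text{D-DIST}(\textsf{LeafColoring}) = \Theta(\log n),\quad \text{R-VOL}(\textsf{LeafColoring}) = \Theta(\log n),\quad \text{D-VOL}(\textsf{LeafColoring}) = \Theta(n). \]
   Context: Computational model. Fix a constant $\Delta$. An input is a graph $G=(V,E)$ on $n$ nodes with maximum degree at most $\Delta$, where each node has a unique identifier in $\{1,\dots,n^\alpha\}$ (some fixed $\alpha\ge1$), a port numbering (for each node $v$ a bijection between the edges incident to $v$ and $\{1,\dots,\deg(v)\}$), and possibly a problem-specific input label; $n$ is known to every node. An algorithm $A$ executed from a node $v$ maintains a set $V_v$ of visited nodes, initially $\{v\}$. In each step it issues a query $(w,j)$ with $w\in V_v$ and $j\in\{1,\dots,\deg(w)\}$ and receives the identifier, the degree and the entire input of the node $u$ reached from $w$ via port $j$; then $u$ is added to $V_v$. The choice of queries may be adaptive. Eventually $A$ halts and outputs the output label of $v$. In the randomized setting every node $u$ has an independent infinite sequence $r_u$ of uniform random bits, regarded as part of $u$'s input (so it is revealed to any execution that visits $u$), read sequentially. The distance cost of an execution from $v$ is $\max_{w\in V_v}\mathrm{dist}(v,w)$ and its volume cost is $|V_v|$. The distance (resp. volume) cost of $A$ on $n$-node graphs is the supremum of this quantity over all labeled graphs with at most $n$ nodes and maximum degree at most $\Delta$ and over all starting nodes. A deterministic algorithm solves a problem $\Pi$ (a set of allowed triples (graph, input labeling,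 output labeling)) if for every allowed input the outputs of the executions from all nodes form a valid output; a randomized algorithm solves $\Pi$ if for every allowed input they form a valid output with probability $1-O(1/n)$ over all random bits. $\text{D-DIST}(\Pi)$, $\text{R-DIST}(\Pi)$, $\text{D-VOL}(\Pi)$, $\text{R-VOL}(\Pi)$ denote the infimum, over deterministic resp. randomized algorithms solving $\Pi$, of the distance resp. volume cost, as functions of $n$. Tree labelings. A (binary) tree labeling assigns to each node $v$ a parent $\mathrm{P}(v)$, a left child $\mathrm{LC}(v)$ and a right child $\mathrm{RC}(v)$, each in $\{1,\dots,\Delta\}\cup\{\bot\}$; a non-$\bot$ value is a port number of $v$ and is identified with the neighbor of $v$ reached through that port (so expressions like $\mathrm{P}(\mathrm{LC}(v))$ make sense). All labelings are assumed well-formed: the non-$\bot$ values among $\mathrm{P}(v),\mathrm{LC}(v),\mathrm{RC}(v)$ are pairwise distinct. A colored tree labeling additionally gives each node a color $\chi_{\mathrm{in}}(v)\in\{R,B\}$. A node $v$ is internal if $\mathrm{LC}(v)\ne\bot$, $\mathrm{P}(\mathrm{LC}(v))=v$, $\mathrm{RC}(v)\neq\bot$ and $\mathrm{P}(\mathrm{RC}(v))=v$; $v$ is a leaf if $\mathrm{LC}(v)=\mathrm{RC}(v)=\bot$ and $\mathrm{P}(v)\ne\bot$ is internal; $v$ is consistent if it is internal or a leaf, and inconsistent otherwise. The problem $\textsf{LeafColoring}$: the input is an arbitrary colored tree labeling; each node outputs $\chi_{\mathrm{out}}(v)\in\{R,B\}$; the output is valid iff for every node $v$: if $v$ is a leaf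 or inconsistent then $\chi_{\mathrm{out}}(v)=\chi_{\mathrm{in}}(v)$, and if $v$ is internal then $\chi_{\mathrm{out}}(v)\in\{\chi_{\mathrm{out}}(\mathrm{LC}(v)),\chi_{\mathrm{out}}(\mathrm{RC}(v))\}$. *)

theory Defs
  imports "HOL-Probability.Probability"
begin

text \<open>Nodes are natural numbers. deg v is the degree of v, port v j (1 <= j <= deg v) is the
neighbour reached from v through port j, ident v the unique identifier, inp v the input of v.\<close>

record 'i lgraph =
  verts :: "nat set"
  deg   :: "nat \<Rightarrow> nat"
  port  :: "nat \<Rightarrow> nat \<Rightarrow> nat"
  ident :: "nat \<Rightarrow> nat"
  inp   :: "nat \<Rightarrow> 'i"

definition wf_graph :: "nat \<Rightarrow> real \<Rightarrow> 'i lgraph \<Rightarrow> bool" where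
  "wf_graph \<Delta> \<alpha> G \<longleftrightarrow>
     finite (verts G) \<and>
     (\<forall>v\<in>verts G. deg G v \<le> \<Delta>) \<and>
     (\<forall>v\<in>verts G. \<forall>j\<in>{1..deg G v}. port G v j \<in> verts G \<and> port G v j \<noteq> v) \<and>
     (\<forall>v\<in>verts G. inj_on (port G v) {1..deg G v}) \<and>
     (\<forall>v\<in>verts G. \<forall>j\<in>{1..deg G v}. \<exists>k\<in>{1..deg G (port G v j)}. port G (port G v j) k = v) \<and>
     inj_on (ident G) (verts G) \<and>
     (\<forall>v\<in>verts G. 1 \<le> ident G v \<and> real (ident G v) \<le> real (card (verts G)) powr \<alpha>)"

definition edges :: "'i lgraph \<Rightarrow> (nat \<times> nat) set" where
  "edges G = {(u, w). u \<in> verts G \<and> (\<exists>j\<in>{1..deg G u}. port G u j = w)}"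

definition gdist :: "'i lgraph \<Rightarrow> nat \<Rightarrow> nat \<Rightarrow> nat" where
  "gdist G u w = (LEAST d. (u, w) \<in> edges G ^^ d)"

datatype 'o action = Query nat nat | Output 'o

text \<open>What is revealed about a node: (identifier, degree, input).\<close>
type_synonym 'i obs = "nat \<times> nat \<times> 'i"

text \<open>An algorithm gets n, the observation of the start node, and the history of queries
(i, j) (query port j of the i-th revealed node, the start node being number 0) together with the
observation of the node reached; it either issues a new query or halts with an output.\<close>
type_synonym ('i, 'o) alg = "nat \<Rightarrow> 'i obs \<Rightarrow> ((nat \<times> nat) \<times> 'i obs) list \<Rightarrow> 'o action"

definition obs :: "'i lgraph \<Rightarrow> nat \<Rightarrow> 'i obs" where
  "obs G u = (ident G u, deg G u, inp G u)"

definition hist :: "'i lgraph \<Rightarrow> ((nat \<times> nat) \<times> nat) list \<Rightarrow> ((nat \<times> nat) \<times> 'i obs) list" where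
  "hist G s = map (\<lambda>(q, u). (q, obs G u)) s"

text \<open>The executed queries (with the actual nodes reached) after k steps. An invalid query
leaves the state unchanged, so the execution never halts.\<close>
fun steps :: "('i, 'o) alg \<Rightarrow> 'i lgraph \<Rightarrow> nat \<Rightarrow> nat \<Rightarrow> ((nat \<times> nat) \<times> nat) list" where
  "steps A G v 0 = []"
| "steps A G v (Suc k) =
     (let s = steps A G v k; ns = v # map snd s in
      case A (card (verts G)) (obs G v) (hist G s) of
        Output out \<Rightarrow> s
      | Query i j \<Rightarrow>
          (if i < length ns \<and> 1 \<le> j \<and> j \<le> deg G (ns ! i)
           then s @ [((i, j), port G (ns ! i) j)] else s))"

definition act :: "('i, 'o) alg \<Rightarrow> 'i lgraph \<Rightarrow> nat \<Rightarrow> nat \<Rightarrow> 'o action" where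
  "act A G v k = A (card (verts G)) (obs G v) (hist G (steps A G v k))"

definition halts :: "('i, 'o) alg \<Rightarrow> 'i lgraph \<Rightarrow> nat \<Rightarrow> bool" where
  "halts A G v \<longleftrightarrow> (\<exists>k out. act A G v k = Output out)"

definition alg_output :: "('i, 'o) alg \<Rightarrow> 'i lgraph \<Rightarrow> nat \<Rightarrow> 'o" where
  "alg_output A G v = (SOME out. \<exists>k. act A G v k = Output out)"

definition visited :: "('i, 'o) alg \<Rightarrow> 'i lgraph \<Rightarrow> nat \<Rightarrow> nat set" where
  "visited A G v = insert v (\<Union>k. set (map snd (steps A G v k)))"

definition dist_exec :: "('i, 'o) alg \<Rightarrow> 'i lgraph \<Rightarrow> nat \<Rightarrow> enat" where
  "dist_exec A G v = (if halts A G v then (SUP w\<in>visited A G v. enat (gdist G v w)) else \<infinity>)"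

definition vol_exec :: "('i, 'o) alg \<Rightarrow> 'i lgraph \<Rightarrow> nat \<Rightarrow> enat" where
  "vol_exec A G v = (if halts A G v then enat (card (visited A G v)) else \<infinity>)"

definition alg_cost ::
  "(('i, 'o) alg \<Rightarrow> 'i lgraph \<Rightarrow> nat \<Rightarrow> enat) \<Rightarrow> ('i lgraph \<Rightarrow> bool) \<Rightarrow> ('i, 'o) alg \<Rightarrow> nat \<Rightarrow> enat" where
  "alg_cost C Inst A n = (SUP G\<in>{G. Inst G \<and> card (verts G) \<le> n}. SUP v\<in>verts G. C A G v)"

datatype color = R | B

record tlab =
  par :: "nat option"
  lc  :: "nat option"
  rc  :: "nat option"
  col :: color

definition wf_tree_lab :: "'i lgraph \<Rightarrow> (nat \<Rightarrow> tlab) \<Rightarrow> bool" where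
  "wf_tree_lab G L \<longleftrightarrow> (\<forall>v\<in>verts G.
     (\<forall>p\<in>{par (L v), lc (L v), rc (L v)}. p = None \<or> (\<exists>j\<in>{1..deg G v}. p = Some j)) \<and>
     (par (L v) \<noteq> None \<longrightarrow> par (L v) \<noteq> lc (L v) \<and> par (L v) \<noteq> rc (L v)) \<and>
     (lc (L v) \<noteq> None \<longrightarrow> lc (L v) \<noteq> rc (L v)))"

definition points :: "'i lgraph \<Rightarrow> nat \<Rightarrow> nat option \<Rightarrow> nat \<Rightarrow> bool" where
  "points G w p v \<longleftrightarrow> (\<exists>j. p = Some j \<and> port G w j = v)"

definition internal :: "'i lgraph \<Rightarrow> (nat \<Rightarrow> tlab) \<Rightarrow> nat \<Rightarrow> bool" where
  "internal G L v \<longleftrightarrow>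
     (\<exists>j. lc (L v) = Some j \<and> points G (port G v j) (par (L (port G v j))) v) \<and>
     (\<exists>j. rc (L v) = Some j \<and> points G (port G v j) (par (L (port G v j))) v)"

definition leaf :: "'i lgraph \<Rightarrow> (nat \<Rightarrow> tlab) \<Rightarrow> nat \<Rightarrow> bool" where
  "leaf G L v \<longleftrightarrow> lc (L v) = None \<and> rc (L v) = None \<and>
     (\<exists>j. par (L v) = Some j \<and> internal G L (port G v j))"

definition consistent :: "'i lgraph \<Rightarrow> (nat \<Rightarrow> tlab) \<Rightarrow> nat \<Rightarrow> bool" where
  "consistent G L v \<longleftrightarrow> internal G L v \<or> leaf G L v"

definition leafcol_valid :: "'i lgraph \<Rightarrow> (nat \<Rightarrow> tlab) \<Rightarrow> (nat \<Rightarrow> color) \<Rightarrow> bool" where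
  "leafcol_valid G L chi \<longleftrightarrow> (\<forall>v\<in>verts G.
     ((leaf G L v \<or> \<not> consistent G L v) \<longrightarrow> chi v = col (L v)) \<and>
     (internal G L v \<longrightarrow>
        (\<exists>j k. lc (L v) = Some j \<and> rc (L v) = Some k \<and>
               (chi v = chi (port G v j) \<or> chi v = chi (port G v k)))))"

definition D_inst :: "nat \<Rightarrow> real \<Rightarrow> tlab lgraph \<Rightarrow> bool" where
  "D_inst \<Delta> \<alpha> G \<longleftrightarrow> wf_graph \<Delta> \<alpha> G \<and> wf_tree_lab G (inp G)"

definition D_solves :: "nat \<Rightarrow> real \<Rightarrow> (tlab, color) alg \<Rightarrow> bool" where
  "D_solves \<Delta> \<alpha> A \<longleftrightarrow> (\<forall>G. D_inst \<Delta> \<alpha> G \<longrightarrow>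
     (\<forall>v\<in>verts G. halts A G v) \<and> leafcol_valid G (inp G) (\<lambda>v. alg_output A G v))"

definition coin_seq :: "(nat \<Rightarrow> bool) measure" where
  "coin_seq = PiM (UNIV :: nat set) (\<lambda>_. measure_pmf (bernoulli_pmf (1/2)))"

definition bitsM :: "nat set \<Rightarrow> (nat \<Rightarrow> nat \<Rightarrow> bool) measure" where
  "bitsM V = PiM V (\<lambda>_. coin_seq)"

definition with_bits :: "tlab lgraph \<Rightarrow> (nat \<Rightarrow> nat \<Rightarrow> bool) \<Rightarrow> (tlab \<times> (nat \<Rightarrow> bool)) lgraph" where
  "with_bits G r = \<lparr>verts = verts G, deg = deg G, port = port G, ident = ident G,
                    inp = (\<lambda>u. (inp G u, r u))\<rparr>"

text \<open>Instances with random bits: the bits are part of the input, so costs are suprema also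
over all values of the random bits.\<close>
definition R_inst :: "nat \<Rightarrow> real \<Rightarrow> (tlab \<times> (nat \<Rightarrow> bool)) lgraph \<Rightarrow> bool" where
  "R_inst \<Delta> \<alpha> H \<longleftrightarrow> wf_graph \<Delta> \<alpha> H \<and> wf_tree_lab H (fst \<circ> inp H)"

definition R_success :: "(tlab \<times> (nat \<Rightarrow> bool), color) alg \<Rightarrow> tlab lgraph \<Rightarrow> (nat \<Rightarrow> nat \<Rightarrow> bool) \<Rightarrow> bool" where
  "R_success A G r \<longleftrightarrow> (let H = with_bits G r in
     (\<forall>v\<in>verts G. halts A H v) \<and> leafcol_valid H (fst \<circ> inp H) (\<lambda>v. alg_output A H v))"

text \<open>Success with probability 1 - O(1/n) (inner probability, i.e. the success event contains a
measurable event of that probability).\<close>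
definition R_solves :: "nat \<Rightarrow> real \<Rightarrow> (tlab \<times> (nat \<Rightarrow> bool), color) alg \<Rightarrow> bool" where
  "R_solves \<Delta> \<alpha> A \<longleftrightarrow> (\<exists>c. \<forall>G. D_inst \<Delta> \<alpha> G \<longrightarrow>
     (\<exists>S\<in>sets (bitsM (verts G)).
        S \<subseteq> {r \<in> space (bitsM (verts G)). R_success A G r} \<and>
        measure (bitsM (verts G)) S \<ge> 1 - c / real (card (verts G))))"

definition enat_le_real :: "enat \<Rightarrow> real \<Rightarrow> bool" where
  "enat_le_real x r \<longleftrightarrow> (\<exists>k. x = enat k \<and> real k \<le> r)"

definition real_le_enat :: "real \<Rightarrow> enat \<Rightarrow> bool" where
  "real_le_enat r x \<longleftrightarrow> x = \<infinity> \<or> (\<exists>k. x = enat k \<and> r \<le> real k)"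

definition bigO_cost :: "(nat \<Rightarrow> enat) \<Rightarrow> (nat \<Rightarrow> real) \<Rightarrow> bool" where
  "bigO_cost c f \<longleftrightarrow> (\<exists>K>0. \<exists>N. \<forall>n\<ge>N. enat_le_real (c n) (K * f n))"

definition bigOmega_cost :: "(nat \<Rightarrow> enat) \<Rightarrow> (nat \<Rightarrow> real) \<Rightarrow> bool" where
  "bigOmega_cost c f \<longleftrightarrow> (\<exists>K>0. \<exists>N. \<forall>n\<ge>N. real_le_enat (K * f n) (c n))"

definition complexity_Theta :: "(('i, 'o) alg \<Rightarrow> bool) \<Rightarrow> (('i, 'o) alg \<Rightarrow> nat \<Rightarrow> enat) \<Rightarrow> (nat \<Rightarrow> real) \<Rightarrow> bool" where
  "complexity_Theta solves cost f \<longleftrightarrow>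
     (\<exists>A. solves A \<and> bigO_cost (cost A) f) \<and> (\<forall>A. solves A \<longrightarrow> bigOmega_cost (cost A) f)"

abbreviation D_DIST_Theta :: "nat \<Rightarrow> real \<Rightarrow> (nat \<Rightarrow> real) \<Rightarrow> bool" where
  "D_DIST_Theta \<Delta> \<alpha> f \<equiv> complexity_Theta (D_solves \<Delta> \<alpha>) (alg_cost dist_exec (D_inst \<Delta> \<alpha>)) f"

abbreviation D_VOL_Theta :: "nat \<Rightarrow> real \<Rightarrow> (nat \<Rightarrow> real) \<Rightarrow> bool" where
  "D_VOL_Theta \<Delta> \<alpha> f \<equiv> complexity_Theta (D_solves \<Delta> \<alpha>) (alg_cost vol_exec (D_inst \<Delta> \<alpha>)) f"

abbreviation R_DIST_Theta :: "nat \<Rightarrow> real \<Rightarrow> (nat \<Rightarrow> real) \<Rightarrow> bool" where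
  "R_DIST_Theta \<Delta> \<alpha> f \<equiv> complexity_Theta (R_solves \<Delta> \<alpha>) (alg_cost dist_exec (R_inst \<Delta> \<alpha>)) f"

abbreviation R_VOL_Theta :: "nat \<Rightarrow> real \<Rightarrow> (nat \<Rightarrow> real) \<Rightarrow> bool" where
  "R_VOL_Theta \<Delta> \<alpha> f \<equiv> complexity_Theta (R_solves \<Delta> \<alpha>) (alg_cost vol_exec (R_inst \<Delta> \<alpha>)) f"

end

theory Submission
  imports Defs
begin

text \<open>Only internal nodes constrain their children, and every node has at most one parent, so the
child relation consists of binary trees and of cycles with trees attached.

Upper bounds. Two words over left/right of the same length lead to different descendants, hence some
descendant at depth at most \<open>log n + 1\<close> is not internal; copying the colour of the nearest one (ties
to the left) is consistent and needs logarithmic distance. With random bits, each node instead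
follows its own coin: walks through a common node merge, so the colour found at the exit is
consistent. A walk is cut off after \<open>2 log n\<close> steps and then answers \<open>R\<close>, which also settles the
cycles. An error requires a walk that exits exactly one step too late; a given exit node determines
the whole path leading to it, so each exit causes this with probability at most \<open>1/n\<^sup>2\<close>.

Lower bounds. If all leaves of a binary tree have colour \<open>c\<close>, the root must answer \<open>c\<close>. In a complete
tree it has to see a leaf for that. A deterministic algorithm can moreover be fed with internal nodes
only, since identifiers are chosen in the order of discovery and the tree is cut off below the
visited part once the algorithm stops.\<close>

section \<open>Executions\<close>

definition seen :: "('i, 'o) alg \<Rightarrow> 'i lgraph \<Rightarrow> nat \<Rightarrow> nat \<Rightarrow> nat set" where
  "seen A G v k = set (v # map snd (steps A G v k))"

lemma seen_0 [simp]: "seen A G v 0 = {v}"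
  by (simp add: seen_def)

lemma start_in_seen: "v \<in> seen A G v k"
  by (simp add: seen_def)

lemma finite_seen [simp]: "finite (seen A G v k)"
  by (simp add: seen_def)

lemma visited_eq_seen: "visited A G v = (\<Union>k. seen A G v k)"
  by (auto simp: visited_def seen_def)

text \<open>Halting and an invalid query both leave the state unchanged, so for inductions over an
  execution a step either does nothing or reaches one node through a port of a known one.\<close>

lemma steps_Suc_cases:
  obtains "steps A G v (Suc k) = steps A G v k"
  | i j w where "w \<in> seen A G v k" "j \<in> {1..deg G w}"
      "steps A G v (Suc k) = steps A G v k @ [((i, j), port G w j)]"
proof (cases "A (card (verts G)) (obs G v) (hist G (steps A G v k))")
  case (Output out)
  then show ?thesis using that(1) by (simp add: Let_def)
next
  case (Query i j)
  let ?ns = "v # map snd (steps A G v k)"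
  show ?thesis
  proof (cases "i < length ?ns \<and> 1 \<le> j \<and> j \<le> deg G (?ns ! i)")
    case True
    then have "?ns ! i \<in> set ?ns" using nth_mem by blast
    then have "?ns ! i \<in> seen A G v k" by (simp add: seen_def)
    with True Query show ?thesis
      by (intro that(2)[of "?ns ! i" j i]) (auto simp: Let_def)
  next
    case False
    with Query show ?thesis using that(1) by (simp add: Let_def)
  qed
qed

lemma seen_Suc_cases:
  obtains "seen A G v (Suc k) = seen A G v k"
  | w j where "w \<in> seen A G v k" "j \<in> {1..deg G w}"
      "seen A G v (Suc k) = insert (port G w j) (seen A G v k)"
  by (rule steps_Suc_cases[of A G v k]) (auto simp: seen_def)

lemma seen_mono:
  assumes "k \<le> l" shows "seen A G v k \<subseteq> seen A G v l"
  using assms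
proof (induction l rule: dec_induct)
  case (step l)
  show ?case using step.IH by (cases rule: seen_Suc_cases[of A G v l]) auto
qed simp

lemma seen_subset_verts:
  assumes "wf_graph \<Delta> \<alpha> G" "v \<in> verts G"
  shows "seen A G v k \<subseteq> verts G"
proof (induction k)
  case (Suc k)
  then show ?case using assms(1)
    by (cases rule: seen_Suc_cases[of A G v k]) (auto simp: wf_graph_def)
qed (simp add: assms)

lemma visited_subset_verts:
  assumes "wf_graph \<Delta> \<alpha> G" "v \<in> verts G"
  shows "visited A G v \<subseteq> verts G"
  using seen_subset_verts[OF assms] by (auto simp: visited_eq_seen)

lemma edges_port:
  "u \<in> verts G \<Longrightarrow> j \<in> {1..deg G u} \<Longrightarrow> (u, port G u j) \<in> edges G"
  by (auto simp: edges_def)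

text \<open>Every newly visited node is adjacent to an older one, so the distance from the start can
grow by at most one for each new node.\<close>
lemma seen_walk_length:
  assumes "wf_graph \<Delta> \<alpha> G" "v \<in> verts G" "w \<in> seen A G v k"
  shows "\<exists>d < card (seen A G v k). (v, w) \<in> edges G ^^ d"
  using assms(3)
proof (induction k arbitrary: w)
  case 0
  then show ?case by auto
next
  case (Suc k)
  show ?case
  proof (cases rule: seen_Suc_cases[of A G v k])
    case 1
    then show ?thesis using Suc by simp
  next
    case (2 x j)
    obtain d where d: "d < card (seen A G v k)" "(v, x) \<in> edges G ^^ d"
      using Suc.IH 2(1) by blast
    have "(x, port G x j) \<in> edges G"
      using 2 seen_subset_verts[OF assms(1,2)] by (blast intro: edges_port)
    with d have walk: "(v, port G x j) \<in> edges G ^^ Suc d" by auto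
    show ?thesis
    proof (cases "w \<in> seen A G v k")
      case True
      then obtain e where "e < card (seen A G v k)" "(v, w) \<in> edges G ^^ e"
        using Suc.IH by blast
      moreover have "card (seen A G v k) \<le> card (seen A G v (Suc k))"
        by (intro card_mono finite_seen seen_mono) simp
      ultimately show ?thesis by (meson less_le_trans)
    next
      case False
      then have "w = port G x j" "card (seen A G v (Suc k)) = Suc (card (seen A G v k))"
        using 2 Suc.prems by auto
      then show ?thesis using walk d(1) by (metis Suc_less_eq)
    qed
  qed
qed

lemma gdist_le: "(u, w) \<in> edges G ^^ d \<Longrightarrow> gdist G u w \<le> d"
  unfolding gdist_def by (rule Least_le)

lemma gdist_walk: "(u, w) \<in> edges G ^^ d \<Longrightarrow> (u, w) \<in> edges G ^^ gdist G u w"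
  unfolding gdist_def by (rule LeastI)

text \<open>The visited nodes are connected to the start through each other, so a distance needs at
  least as many visited nodes.\<close>

lemma dist_exec_le_vol_exec:
  assumes "wf_graph \<Delta> \<alpha> G" "v \<in> verts G"
  shows "dist_exec A G v \<le> vol_exec A G v"
proof (cases "halts A G v")
  case True
  have "gdist G v w \<le> card (visited A G v)" if w: "w \<in> visited A G v" for w
  proof -
    obtain k where k: "w \<in> seen A G v k" using w by (auto simp: visited_eq_seen)
    obtain d where "d < card (seen A G v k)" "(v, w) \<in> edges G ^^ d"
      using seen_walk_length[OF assms k] by blast
    moreover have "finite (visited A G v)"
      using visited_subset_verts[OF assms] assms(1) unfolding wf_graph_def by (metis finite_subset)
    then have "card (seen A G v k) \<le> card (visited A G v)"
      by (intro card_mono) (auto simp: visited_eq_seen)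
    ultimately show ?thesis using gdist_le by fastforce
  qed
  then show ?thesis using True by (auto simp: dist_exec_def vol_exec_def intro!: SUP_least)
qed (simp add: vol_exec_def)

text \<open>Everything an algorithm can learn while its known nodes lie in \<open>S\<close>. The
  number of vertices is included because it is announced; the vertex sets themselves may
  differ.\<close>

definition agree_on :: "nat set \<Rightarrow> 'i lgraph \<Rightarrow> 'i lgraph \<Rightarrow> bool" where
  "agree_on S G G' \<longleftrightarrow> card (verts G) = card (verts G') \<and>
     (\<forall>u\<in>S. deg G u = deg G' u \<and> port G u = port G' u \<and> obs G u = obs G' u)"

lemma agree_on_subset: "agree_on S G G' \<Longrightarrow> T \<subseteq> S \<Longrightarrow> agree_on T G G'"
  by (auto simp: agree_on_def)

lemma hist_agree:
  "agree_on (seen A G v k) G G' \<Longrightarrow> hist G' (steps A G v k) = hist G (steps A G v k)"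
  by (force simp: hist_def agree_on_def seen_def)

lemma steps_Suc_agree:
  assumes ag: "agree_on (seen A G v k) G G'" and eq: "steps A G' v k = steps A G v k"
  shows "steps A G' v (Suc k) = steps A G v (Suc k)"
proof -
  let ?ns = "v # map snd (steps A G v k)"
  have "?ns ! i \<in> seen A G v k" if "i < length ?ns" for i
    using nth_mem[OF that] by (simp add: seen_def)
  then have nth: "deg G' (?ns ! i) = deg G (?ns ! i) \<and> port G' (?ns ! i) = port G (?ns ! i)"
    if "i < length ?ns" for i
    using ag that by (auto simp: agree_on_def)
  have "obs G' v = obs G v" "card (verts G') = card (verts G)"
    using ag start_in_seen[of v A G k] by (auto simp: agree_on_def)
  then show ?thesis
    using nth hist_agree[OF ag]
    by (auto simp: Let_def eq split: action.splits)
qed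

text \<open>The query made in step \<open>k + 1\<close> depends only on nodes known after
  \<open>k\<close> steps, hence the bound \<open>Suc k\<close>. The node reached by it is the same
  in both graphs, but its observation may differ; the adversary relies on this.\<close>

lemma steps_agree:
  assumes "agree_on (seen A G v k) G G'" "l \<le> Suc k"
  shows "steps A G' v l = steps A G v l"
  using assms(2)
proof (induction l)
  case (Suc l)
  then have "agree_on (seen A G v l) G G'"
    using assms(1) seen_mono[of l k A G v] agree_on_subset by auto
  then show ?case by (rule steps_Suc_agree) (use Suc in simp)
qed simp

lemma seen_agree:
  "agree_on (seen A G v k) G G' \<Longrightarrow> l \<le> Suc k \<Longrightarrow> seen A G' v l = seen A G v l"
  using steps_agree[of A G v k G' l] by (simp add: seen_def)

text \<open>All actions coincide, so \<open>SOME\<close> picks the same value on both sides, also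
  for an execution that never halts.\<close>

lemma alg_output_agree:
  assumes "agree_on (visited A G v) G G'"
  shows "alg_output A G' v = alg_output A G v"
proof -
  have ag: "agree_on (seen A G v k) G G'" for k
    using assms by (auto simp: visited_eq_seen intro: agree_on_subset)
  have "act A G' v k = act A G v k" for k
    using ag[of k] steps_agree[OF ag[of k], of k] hist_agree[OF ag[of k]] start_in_seen[of v A G k]
    by (auto simp: act_def agree_on_def)
  then show ?thesis by (simp add: alg_output_def)
qed

lemma steps_halted:
  assumes "act A G v k = Output x" "k \<le> l"
  shows "steps A G v l = steps A G v k"
  using assms(2)
proof (induction l rule: dec_induct)
  case (step l)
  then show ?case using assms(1) by (simp add: act_def Let_def)
qed simp

lemma
  assumes k: "act A G v k = Output x"
  shows halts_act: "halts A G v"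
    and alg_output_act: "alg_output A G v = x"
    and visited_act: "visited A G v = seen A G v k"
proof -
  show "halts A G v" using k by (auto simp: halts_def)
  have "y = x" if "act A G v l = Output y" for l y
    using steps_halted[OF k, of l] steps_halted[OF that, of k] k that
    by (cases "k \<le> l") (auto simp: act_def)
  then show "alg_output A G v = x"
    unfolding alg_output_def using k by (intro some_equality) blast+
  have "seen A G v l \<subseteq> seen A G v k" for l
    using steps_halted[OF k, of l] seen_mono[of l k A G v]
    by (cases "k \<le> l") (auto simp: seen_def)
  then show "visited A G v = seen A G v k" by (auto simp: visited_eq_seen)
qed

section \<open>Query programs\<close>

text \<open>The continuation of \<open>Ask i j\<close> receives the number of the node reached as well as its
observation, so programs can refer back to any node found earlier.\<close>
datatype ('i, 'o) prog = Ret 'o | Ask nat nat "nat \<Rightarrow> 'i obs \<Rightarrow> ('i, 'o) prog"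

text \<open>\<open>m\<close> is the number that the next revealed node receives. The start node is
  number 0, so runs begin with 1.\<close>

fun resume :: "nat \<Rightarrow> ('i, 'o) prog \<Rightarrow> ((nat \<times> nat) \<times> 'i obs) list \<Rightarrow> ('i, 'o) prog" where
  "resume m p [] = p"
| "resume m (Ret x) (e # h) = Ret x"
| "resume m (Ask i j f) (e # h) = resume (Suc m) (f m (snd e)) h"

text \<open>An algorithm is a function of the history without a state of its own, so the program is
  replayed from its beginning at every step.\<close>

definition alg_of :: "(nat \<Rightarrow> 'i obs \<Rightarrow> ('i, 'o) prog) \<Rightarrow> ('i, 'o) alg" where
  "alg_of P n ob h = (case resume 1 (P n ob) h of Ret x \<Rightarrow> Output x | Ask i j f \<Rightarrow> Query i j)"

lemma resume_snoc:
  "resume m p (h @ [e]) =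
     (case resume m p h of Ret x \<Rightarrow> Ret x | Ask i j f \<Rightarrow> f (m + length h) (snd e))"
  by (induction m p h rule: resume.induct) (auto split: prog.splits)

text \<open>\<open>ns\<close> lists the visited nodes in the order of their numbers. A derivation
  may stop at any intermediate program, so runs of subprograms compose by
  \<open>exec_trans\<close>.\<close>

inductive exec :: "'i lgraph \<Rightarrow> nat list \<Rightarrow> ('i, 'o) prog \<Rightarrow> nat list \<Rightarrow> ('i, 'o) prog \<Rightarrow> bool"
  for G :: "'i lgraph" where
  exec_refl: "exec G ns p ns p"
| exec_Ask: "i < length ns \<Longrightarrow> j \<in> {1..deg G (ns ! i)} \<Longrightarrow> u = port G (ns ! i) j \<Longrightarrow>
    exec G (ns @ [u]) (f (length ns) (obs G u)) ns' p' \<Longrightarrow> exec G ns (Ask i j f) ns' p'"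

lemma exec_trans: "exec G ns p ns' p' \<Longrightarrow> exec G ns' p' ns'' p'' \<Longrightarrow> exec G ns p ns'' p''"
  by (induction rule: exec.induct) (auto intro: exec_Ask)

lemma exec_steps:
  assumes "exec G ns p ns' p'"
    and "v # map snd (steps (alg_of P) G v k) = ns"
    and "resume 1 (P (card (verts G)) (obs G v)) (hist G (steps (alg_of P) G v k)) = p"
  shows "\<exists>k'. v # map snd (steps (alg_of P) G v k') = ns' \<and>
    resume 1 (P (card (verts G)) (obs G v)) (hist G (steps (alg_of P) G v k')) = p'"
  using assms
proof (induction arbitrary: k rule: exec.induct)
  case (exec_Ask i ns j u f ns' p')
  let ?s = "steps (alg_of P) G v k"
  have "alg_of P (card (verts G)) (obs G v) (hist G ?s) = Query i j"
    by (subst alg_of_def, subst exec_Ask.prems(2)) simp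
  then have st: "steps (alg_of P) G v (Suc k) = ?s @ [((i, j), u)]"
    using exec_Ask.hyps(1,2,3) unfolding exec_Ask.prems(1)[symmetric] by (simp add: Let_def)
  have "resume 1 (P (card (verts G)) (obs G v)) (hist G (steps (alg_of P) G v (Suc k)))
      = f (length ns) (obs G u)"
    using exec_Ask.prems unfolding st by (auto simp: hist_def resume_snoc)
  moreover have "v # map snd (steps (alg_of P) G v (Suc k)) = ns @ [u]"
    using exec_Ask.prems unfolding st by auto
  ultimately show ?case by (rule exec_Ask.IH[rotated])
qed blast

lemma
  assumes "exec G [v] (P (card (verts G)) (obs G v)) ns (Ret x)"
  shows halts_alg_of: "halts (alg_of P) G v"
    and alg_output_alg_of: "alg_output (alg_of P) G v = x"
    and visited_alg_of: "visited (alg_of P) G v = set ns"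
proof -
  obtain k where ns: "v # map snd (steps (alg_of P) G v k) = ns"
    and r: "resume 1 (P (card (verts G)) (obs G v)) (hist G (steps (alg_of P) G v k)) = Ret x"
    using exec_steps[OF assms, of v P 0] by (auto simp: hist_def)
  have "act (alg_of P) G v k = Output x" unfolding act_def by (subst alg_of_def, subst r) simp
  from halts_act[OF this] alg_output_act[OF this] visited_act[OF this] ns
  show "halts (alg_of P) G v" "alg_output (alg_of P) G v = x" "visited (alg_of P) G v = set ns"
    by (auto simp: seen_def)
qed

section \<open>Tree labelings and query programs for them\<close>

definition left_child :: "'i lgraph \<Rightarrow> (nat \<Rightarrow> tlab) \<Rightarrow> nat \<Rightarrow> nat" where
  "left_child G L v = port G v (the (lc (L v)))"

definition right_child :: "'i lgraph \<Rightarrow> (nat \<Rightarrow> tlab) \<Rightarrow> nat \<Rightarrow> nat" where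
  "right_child G L v = port G v (the (rc (L v)))"

definition parent :: "'i lgraph \<Rightarrow> (nat \<Rightarrow> tlab) \<Rightarrow> nat \<Rightarrow> nat" where
  "parent G L v = port G v (the (par (L v)))"

definition points_back :: "'i lgraph \<Rightarrow> (nat \<Rightarrow> tlab) \<Rightarrow> nat \<Rightarrow> nat option \<Rightarrow> bool" where
  "points_back G L v p \<longleftrightarrow>
     (\<exists>j. p = Some j \<and> points G (port G v j) (par (L (port G v j))) v)"

lemma internal_points_back:
  "internal G L v \<longleftrightarrow> points_back G L v (lc (L v)) \<and> points_back G L v (rc (L v))"
  by (simp add: internal_def points_back_def)

text \<open>A leaf has no left child and so is not internal; leaves and inconsistent nodes together
  are exactly the nodes that are not internal. From here on only that dichotomy matters.\<close>

lemma leafcol_valid_iff: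
  "leafcol_valid G L chi \<longleftrightarrow> (\<forall>v\<in>verts G.
     if internal G L v
     then chi v = chi (left_child G L v) \<or> chi v = chi (right_child G L v)
     else chi v = col (L v))"
proof -
  have lc: "lc (L v) \<noteq> None" if "internal G L v" for v using that unfolding internal_def by blast
  have 1: "leaf G L v \<or> \<not> consistent G L v \<longleftrightarrow> \<not> internal G L v" for v
    using lc[of v] unfolding leaf_def consistent_def by blast
  have 2: "(\<exists>j k. lc (L v) = Some j \<and> rc (L v) = Some k \<and>
      (chi v = chi (port G v j) \<or> chi v = chi (port G v k))) \<longleftrightarrow>
      chi v = chi (left_child G L v) \<or> chi v = chi (right_child G L v)" if int: "internal G L v" for v
  proof -
    obtain j k where "lc (L v) = Some j" "rc (L v) = Some k" using int unfolding internal_def by blast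
    then show ?thesis by (simp add: left_child_def right_child_def)
  qed
  show ?thesis unfolding leafcol_valid_def 1 using 2 by meson
qed

text \<open>The labeling is kept apart from \<open>inp\<close>, so that inputs with and without
  random bits are treated alike.\<close>

locale tree_instance =
  fixes \<Delta> :: nat and \<alpha> :: real and G :: "'i lgraph" and L :: "nat \<Rightarrow> tlab"
  assumes wf: "wf_graph \<Delta> \<alpha> G" and wf_lab: "wf_tree_lab G L"
begin

lemma label_port:
  assumes "v \<in> verts G" "p \<in> {par (L v), lc (L v), rc (L v)}" "p = Some j"
  shows "j \<in> {1..deg G v}" "port G v j \<in> verts G" "(v, port G v j) \<in> edges G"
proof -
  have "\<forall>p\<in>{par (L v), lc (L v), rc (L v)}. p = None \<or> (\<exists>j\<in>{1..deg G v}. p = Some j)"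
    using bspec[OF wf_lab[unfolded wf_tree_lab_def] assms(1)] by (rule conjunct1)
  from bspec[OF this assms(2)] show j: "j \<in> {1..deg G v}" unfolding assms(3) by simp
  show "port G v j \<in> verts G" using wf assms(1) j unfolding wf_graph_def by blast
  show "(v, port G v j) \<in> edges G" using edges_port[OF assms(1) j] .
qed

lemma children_edges:
  assumes "v \<in> verts G" "internal G L v"
  shows "left_child G L v \<in> verts G" "(v, left_child G L v) \<in> edges G"
    "right_child G L v \<in> verts G" "(v, right_child G L v) \<in> edges G"
proof -
  obtain j k where "lc (L v) = Some j" "rc (L v) = Some k"
    using assms(2) by (auto simp: internal_def)
  then show "left_child G L v \<in> verts G" "(v, left_child G L v) \<in> edges G"
    "right_child G L v \<in> verts G" "(v, right_child G L v) \<in> edges G"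
    using label_port[OF assms(1), of "lc (L v)"] label_port[OF assms(1), of "rc (L v)"]
    by (simp_all add: left_child_def right_child_def)
qed

lemma children_distinct:
  assumes "v \<in> verts G" "internal G L v"
  shows "left_child G L v \<noteq> right_child G L v"
proof -
  obtain j k where jk: "lc (L v) = Some j" "rc (L v) = Some k"
    using assms(2) by (auto simp: internal_def)
  have "lc (L v) \<noteq> None \<longrightarrow> lc (L v) \<noteq> rc (L v)"
    using bspec[OF wf_lab[unfolded wf_tree_lab_def] assms(1)] by (elim conjE)
  with jk have "j \<noteq> k" by simp
  moreover have "inj_on (port G v) {1..deg G v}" using wf assms(1) by (simp add: wf_graph_def)
  ultimately show ?thesis
    using label_port(1)[OF assms(1), of "lc (L v)" j] label_port(1)[OF assms(1), of "rc (L v)" k] jk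
    by (simp add: left_child_def right_child_def inj_on_eq_iff)
qed

lemma parent_child:
  assumes "internal G L v"
  shows "parent G L (left_child G L v) = v" "parent G L (right_child G L v) = v"
  using assms by (auto simp: internal_def points_def parent_def left_child_def right_child_def)

lemma ident_eq_iff: "u \<in> verts G \<Longrightarrow> v \<in> verts G \<Longrightarrow> ident G u = ident G v \<longleftrightarrow> u = v"
  using wf unfolding wf_graph_def by (meson inj_on_eq_iff)

end

subsection \<open>Testing whether a node is internal\<close>

type_synonym 'i handle = "nat \<times> 'i obs"

text \<open>Goes to the child, then through the child's parent port, and compares identifiers, since
  the program cannot compare nodes directly. A handle is a node's number with its
  observation.\<close>

definition ask_child ::
  "('i \<Rightarrow> tlab) \<Rightarrow> 'i handle \<Rightarrow> nat option \<Rightarrow> ('i handle option \<Rightarrow> ('i, 'o) prog) \<Rightarrow> ('i, 'o) prog" where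
  "ask_child lb h p k = (case p of None \<Rightarrow> k None
     | Some j \<Rightarrow> Ask (fst h) j (\<lambda>a oa. case par (lb (snd (snd oa))) of None \<Rightarrow> k None
         | Some q \<Rightarrow> Ask a q (\<lambda>_ ob. k (if fst ob = fst (snd h) then Some (a, oa) else None))))"

definition label_of :: "('i \<Rightarrow> tlab) \<Rightarrow> 'i handle \<Rightarrow> tlab" where
  "label_of lb h = lb (snd (snd (snd h)))"

definition ask_children ::
  "('i \<Rightarrow> tlab) \<Rightarrow> 'i handle \<Rightarrow> (('i handle \<times> 'i handle) option \<Rightarrow> ('i, 'o) prog) \<Rightarrow> ('i, 'o) prog" where
  "ask_children lb h k =
     ask_child lb h (lc (label_of lb h)) (\<lambda>x. case x of None \<Rightarrow> k None
       | Some a \<Rightarrow> ask_child lb h (rc (label_of lb h)) (\<lambda>y. case y of None \<Rightarrow> k None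
           | Some b \<Rightarrow> k (Some (a, b))))"

definition handle_of :: "'i lgraph \<Rightarrow> nat list \<Rightarrow> 'i handle \<Rightarrow> nat \<Rightarrow> bool" where
  "handle_of G ns h v \<longleftrightarrow> fst h < length ns \<and> ns ! fst h = v \<and> snd h = obs G v"

lemma handle_of_append: "handle_of G ns h v \<Longrightarrow> handle_of G (ns @ ms) h v"
  by (auto simp: handle_of_def nth_append)

definition near :: "'i lgraph \<Rightarrow> nat \<Rightarrow> nat \<Rightarrow> nat set" where
  "near G v d = {u. \<exists>e\<le>d. (v, u) \<in> edges G ^^ e}"

lemma near_mono: "d \<le> e \<Longrightarrow> near G v d \<subseteq> near G v e"
  unfolding near_def by (blast intro: order_trans)

lemma near_edge:
  assumes "(v, w) \<in> edges G" shows "near G w d \<subseteq> near G v (Suc d)"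
proof
  fix u assume "u \<in> near G w d"
  then obtain e where "e \<le> d" "(w, u) \<in> edges G ^^ e" by (auto simp: near_def)
  with assms have "Suc e \<le> Suc d \<and> (v, u) \<in> edges G ^^ Suc e"
    by (meson Suc_le_mono relpow_Suc_I2)
  then show "u \<in> near G v (Suc d)" unfolding near_def by blast
qed

lemma near_refl: "v \<in> near G v d"
  unfolding near_def by (auto intro!: exI[of _ 0])

locale labeled_instance = tree_instance \<Delta> \<alpha> G "\<lambda>v. lb (inp G v)"
  for \<Delta> :: nat and \<alpha> :: real and G :: "'i lgraph" and lb :: "'i \<Rightarrow> tlab"
begin

abbreviation lab :: "nat \<Rightarrow> tlab" where "lab \<equiv> \<lambda>v. lb (inp G v)"

lemma label_of_handle: "handle_of G ns h v \<Longrightarrow> label_of lb h = lab v"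
  by (simp add: handle_of_def label_of_def obs_def)

text \<open>The bound on \<open>length ms\<close> feeds the volume estimate, the inclusion in
  \<open>near\<close> the distance estimate.\<close>

lemma exec_ask_child:
  assumes v: "v \<in> verts G" and h: "handle_of G ns h v" and p: "p \<in> {lc (lab v), rc (lab v)}"
  obtains ms r where "length ms \<le> 2" "set ms \<subseteq> near G v 2"
    "exec G ns (ask_child lb h p k) (ns @ ms) (k r)"
    "points_back G lab v p \<Longrightarrow> \<exists>a. r = Some a \<and> handle_of G (ns @ ms) a (port G v (the p))"
    "\<not> points_back G lab v p \<Longrightarrow> r = None"
proof (cases p)
  case None
  then show ?thesis
    by (intro that[of "[]" None]) (auto simp: ask_child_def points_back_def intro: exec_refl)
next
  case (Some j)
  define w where "w = port G v j"
  have j: "j \<in> {1..deg G v}" and w: "w \<in> verts G" "(v, w) \<in> edges G"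
    using label_port[OF v, of p j] p Some by (auto simp: w_def)
  have fh: "fst h < length ns" "ns ! fst h = v" "fst (snd h) = ident G v"
    using h by (auto simp: handle_of_def obs_def)
  have nw: "w \<in> near G v 2" using near_edge[OF w(2), of 1] near_refl[of w G 1] by (auto simp: numeral_2_eq_2)
  have hw: "handle_of G (ns @ [w]) (length ns, obs G w) w" by (simp add: handle_of_def)
  show ?thesis
  proof (cases "par (lab w)")
    case None
    have "exec G ns (ask_child lb h p k) (ns @ [w]) (k None)"
      unfolding ask_child_def Some option.case
      by (rule exec_Ask[of "fst h" _ _ _ w]) (use fh j None in \<open>auto simp: w_def obs_def intro: exec_refl\<close>)
    then show ?thesis using None nw Some
      by (intro that[of "[w]" None]) (auto simp: points_back_def points_def w_def)
  next
    case (Some q)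
    define x where "x = port G w q"
    have q: "q \<in> {1..deg G w}" and x: "x \<in> verts G" "(w, x) \<in> edges G"
      using label_port[OF w(1), of "par (lab w)" q] Some by (auto simp: x_def)
    have nx: "x \<in> near G v 2"
      using near_edge[OF w(2), of 1] near_edge[OF x(2), of 0] near_refl[of x G 0] by (auto simp: numeral_2_eq_2)
    let ?r = "if ident G x = ident G v then Some (length ns, obs G w) else None"
    have "exec G ns (ask_child lb h p k) (ns @ [w, x]) (k ?r)"
      unfolding ask_child_def \<open>p = Some j\<close> option.case
      apply (rule exec_Ask[of "fst h" _ _ _ w])
         apply (use fh j in \<open>auto simp: w_def\<close>)[3]
      unfolding obs_def snd_conv Some option.case
      by (rule exec_Ask[of "length ns" _ _ _ x]) (use fh q Some in \<open>auto simp: x_def obs_def intro: exec_refl\<close>)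
    moreover have "points_back G lab v p \<longleftrightarrow> ident G x = ident G v"
      using Some \<open>p = Some j\<close> ident_eq_iff[OF x(1) v] by (auto simp: points_back_def points_def w_def x_def)
    ultimately show ?thesis
      using nw nx handle_of_append[OF hw, of "[x]"] \<open>p = Some j\<close>
      by (intro that[of "[w, x]" ?r]) (auto simp: w_def)
  qed
qed

lemma exec_ask_children:
  assumes v: "v \<in> verts G" and h: "handle_of G ns h v"
  obtains ms r where "length ms \<le> 4" "set ms \<subseteq> near G v 2"
    "exec G ns (ask_children lb h k) (ns @ ms) (k r)"
    "internal G lab v \<Longrightarrow> \<exists>a b. r = Some (a, b) \<and>
       handle_of G (ns @ ms) a (left_child G lab v) \<and> handle_of G (ns @ ms) b (right_child G lab v)"
    "\<not> internal G lab v \<Longrightarrow> r = None"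
proof -
  let ?k2 = "\<lambda>a y. case y of None \<Rightarrow> k None | Some b \<Rightarrow> k (Some (a, b))"
  let ?k1 = "\<lambda>x. case x of None \<Rightarrow> k None
       | Some a \<Rightarrow> ask_child lb h (rc (label_of lb h)) (?k2 a)"
  obtain ms r where 1: "length ms \<le> 2" "set ms \<subseteq> near G v 2"
    "exec G ns (ask_child lb h (lc (lab v)) ?k1) (ns @ ms) (?k1 r)"
    "points_back G lab v (lc (lab v)) \<Longrightarrow> \<exists>a. r = Some a \<and> handle_of G (ns @ ms) a (left_child G lab v)"
    "\<not> points_back G lab v (lc (lab v)) \<Longrightarrow> r = None"
    by (rule exec_ask_child[OF v h, of "lc (lab v)" ?k1]) (auto simp: left_child_def)
  have e1: "exec G ns (ask_children lb h k) (ns @ ms) (?k1 r)"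
    using 1(3) by (simp add: ask_children_def label_of_handle[OF h])
  show ?thesis
  proof (cases "points_back G lab v (lc (lab v))")
    case False
    then show ?thesis using 1 e1
      by (intro that[of ms None]) (auto simp: internal_points_back)
  next
    case True
    then obtain a where a: "r = Some a" "handle_of G (ns @ ms) a (left_child G lab v)" using 1(4) by blast
    have h': "handle_of G (ns @ ms) h v" using h by (rule handle_of_append)
    obtain ms' r' where 2: "length ms' \<le> 2" "set ms' \<subseteq> near G v 2"
      "exec G (ns @ ms) (ask_child lb h (rc (lab v)) (?k2 a)) ((ns @ ms) @ ms') (?k2 a r')"
      "points_back G lab v (rc (lab v)) \<Longrightarrow>
         \<exists>b. r' = Some b \<and> handle_of G ((ns @ ms) @ ms') b (right_child G lab v)"
      "\<not> points_back G lab v (rc (lab v)) \<Longrightarrow> r' = None"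
      by (rule exec_ask_child[OF v h', of "rc (lab v)" "?k2 a"]) (auto simp: right_child_def)
    have "exec G ns (ask_children lb h k) (ns @ (ms @ ms')) (?k2 a r')"
      using exec_trans[OF e1[unfolded a(1) option.case label_of_handle[OF h]] 2(3)] by simp
    moreover have "?k2 a r' = k (map_option (Pair a) r')" by (cases r') auto
    ultimately have e: "exec G ns (ask_children lb h k) (ns @ (ms @ ms')) (k (map_option (Pair a) r'))"
      by simp
    have a': "handle_of G (ns @ (ms @ ms')) a (left_child G lab v)"
      using handle_of_append[OF a(2), of ms'] by simp
    show ?thesis
    proof (rule that[OF _ _ e])
      show "length (ms @ ms') \<le> 4" "set (ms @ ms') \<subseteq> near G v 2" using 1(1,2) 2(1,2) by auto
      show "map_option (Pair a) r' = None" if "\<not> internal G lab v"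
        using that True 2(5) by (simp add: internal_points_back)
      assume "internal G lab v"
      then obtain b where "r' = Some b" "handle_of G ((ns @ ms) @ ms') b (right_child G lab v)"
        using 2(4) unfolding internal_points_back by blast
      with a' show "\<exists>a' b. map_option (Pair a) r' = Some (a', b) \<and>
          handle_of G (ns @ (ms @ ms')) a' (left_child G lab v) \<and>
          handle_of G (ns @ (ms @ ms')) b (right_child G lab v)" by simp
    qed
  qed
qed

end

section \<open>The deterministic algorithm\<close>

text \<open>The first component is the distance to the nearest non-internal descendant, capped at
  the horizon. Depth 0 answers without a test, so a value equal to the horizon means that no exit
  was found above it.\<close>

primrec nearest_exit :: "'i lgraph \<Rightarrow> (nat \<Rightarrow> tlab) \<Rightarrow> nat \<Rightarrow> nat \<Rightarrow> nat \<times> color" where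
  "nearest_exit G L 0 v = (0, col (L v))"
| "nearest_exit G L (Suc d) v =
     (if internal G L v
      then let (m, c) = nearest_exit G L d (left_child G L v);
               (m', c') = nearest_exit G L d (right_child G L v)
           in if m \<le> m' then (Suc m, c) else (Suc m', c')
      else (0, col (L v)))"

primrec ask_nearest ::
  "('i \<Rightarrow> tlab) \<Rightarrow> nat \<Rightarrow> 'i handle \<Rightarrow> (nat \<times> color \<Rightarrow> ('i, 'o) prog) \<Rightarrow> ('i, 'o) prog" where
  "ask_nearest lb 0 h k = k (0, col (label_of lb h))"
| "ask_nearest lb (Suc d) h k = ask_children lb h (\<lambda>x. case x of
       None \<Rightarrow> k (0, col (label_of lb h))
     | Some (a, b) \<Rightarrow> ask_nearest lb d a (\<lambda>(m, c). ask_nearest lb d b (\<lambda>(m', c').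
         k (if m \<le> m' then (Suc m, c) else (Suc m', c')))))"

text \<open>The deepest nodes tested have depth \<open>d - 1\<close>, and testing a node looks two
  steps further, which gives the radius \<open>Suc d\<close>.\<close>

lemma (in labeled_instance) exec_ask_nearest:
  assumes "v \<in> verts G" "handle_of G ns h v"
  shows "\<exists>ms. set ms \<subseteq> near G v (Suc d) \<and>
    exec G ns (ask_nearest lb d h k) (ns @ ms) (k (nearest_exit G lab d v))"
  using assms
proof (induction d arbitrary: v ns h k)
  case 0
  then show ?case by (auto simp: label_of_handle intro!: exI[of _ "[]"] intro: exec_refl)
next
  case (Suc d)
  define k1 where "k1 x = (case x of
       None \<Rightarrow> k (0, col (label_of lb h))
     | Some (a, b) \<Rightarrow> ask_nearest lb d a (\<lambda>(m, c). ask_nearest lb d b (\<lambda>(m', c').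
         k (if m \<le> m' then (Suc m, c) else (Suc m', c')))))" for x
  obtain ms r where 1: "set ms \<subseteq> near G v 2"
    "exec G ns (ask_children lb h k1) (ns @ ms) (k1 r)"
    "internal G lab v \<Longrightarrow> \<exists>a b. r = Some (a, b) \<and>
       handle_of G (ns @ ms) a (left_child G lab v) \<and> handle_of G (ns @ ms) b (right_child G lab v)"
    "\<not> internal G lab v \<Longrightarrow> r = None"
    by (rule exec_ask_children[OF Suc.prems, of k1]) blast
  have n2: "near G v 2 \<subseteq> near G v (Suc (Suc d))" by (rule near_mono) simp
  have e1: "exec G ns (ask_nearest lb (Suc d) h k) (ns @ ms) (k1 r)"
    using 1(2) by (simp add: k1_def[abs_def])
  show ?case
  proof (cases "internal G lab v")
    case False
    then show ?thesis
      using e1 1(1,4) n2 label_of_handle[OF Suc.prems(2)] by (auto simp: k1_def intro!: exI[of _ ms])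
  next
    case True
    then obtain a b where ab: "r = Some (a, b)" "handle_of G (ns @ ms) a (left_child G lab v)"
      "handle_of G (ns @ ms) b (right_child G lab v)" using 1(3) by blast
    note ch = children_edges[OF Suc.prems(1) True]
    obtain m c where mc: "nearest_exit G lab d (left_child G lab v) = (m, c)" by fastforce
    obtain m' c' where mc': "nearest_exit G lab d (right_child G lab v) = (m', c')" by fastforce
    define k3 where "k3 = (\<lambda>m c (m', c'). k (if m \<le> m' then (Suc m, c) else (Suc m', c')))"
    define k2 where "k2 = (\<lambda>(m, c). ask_nearest lb d b (k3 m c))"
    obtain ms1 where 2: "set ms1 \<subseteq> near G (left_child G lab v) (Suc d)"
      "exec G (ns @ ms) (ask_nearest lb d a k2) ((ns @ ms) @ ms1) (k2 (m, c))"
      using Suc.IH[OF ch(1) ab(2), of k2] mc by auto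
    have "handle_of G ((ns @ ms) @ ms1) b (right_child G lab v)" using ab(3) by (rule handle_of_append)
    then obtain ms2 where 3: "set ms2 \<subseteq> near G (right_child G lab v) (Suc d)"
      "exec G ((ns @ ms) @ ms1) (ask_nearest lb d b (k3 m c)) (((ns @ ms) @ ms1) @ ms2) (k3 m c (m', c'))"
      using Suc.IH[OF ch(3), of _ b "k3 m c"] mc' by fastforce
    have "k1 r = ask_nearest lb d a k2"
      by (simp add: ab(1) k1_def k2_def k3_def)
    moreover have "k2 (m, c) = ask_nearest lb d b (k3 m c)" by (simp add: k2_def)
    moreover have "k3 m c (m', c') = k (nearest_exit G lab (Suc d) v)"
      using True by (simp add: k3_def mc mc')
    ultimately have "exec G ns (ask_nearest lb (Suc d) h k) (ns @ (ms @ ms1 @ ms2))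
        (k (nearest_exit G lab (Suc d) v))"
      using exec_trans[OF e1] exec_trans[OF 2(2)] 3(2) by simp
    moreover have "set (ms @ ms1 @ ms2) \<subseteq> near G v (Suc (Suc d))"
      using subset_trans[OF 1(1) n2] subset_trans[OF 2(1) near_edge[OF ch(2)]]
        subset_trans[OF 3(1) near_edge[OF ch(4)]] by simp
    ultimately show ?thesis by blast
  qed
qed

section \<open>Depth of the nearest exit and validity of the deterministic output\<close>

context tree_instance
begin

text \<open>Validity compares a node with its children at the same horizon, whereas the recursion
  evaluates the children at a horizon smaller by one. An exit inside the horizon survives its
  growth: a capped branch still has distance at least \<open>d\<close>, so it cannot win the
  comparison afterwards.\<close>

lemma nearest_exit_stable:
  "(fst (nearest_exit G L d v) < d \<longrightarrow> nearest_exit G L (Suc d) v = nearest_exit G L d v) \<and>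
   (d \<le> fst (nearest_exit G L d v) \<longrightarrow> d \<le> fst (nearest_exit G L (Suc d) v))"
proof (induction d arbitrary: v)
  case (Suc d)
  let ?f = "nearest_exit G L" and ?l = "left_child G L v" and ?r = "right_child G L v"
  obtain m1 c1 m2 c2 n1 e1 n2 e2 where
    f: "?f d ?l = (m1, c1)" "?f d ?r = (m2, c2)" "?f (Suc d) ?l = (n1, e1)" "?f (Suc d) ?r = (n2, e2)"
    by (metis surj_pair)
  have "?f (Suc d) v = (if internal G L v
      then if m1 \<le> m2 then (Suc m1, c1) else (Suc m2, c2) else (0, col (L v)))"
    "?f (Suc (Suc d)) v = (if internal G L v
      then if n1 \<le> n2 then (Suc n1, e1) else (Suc n2, e2) else (0, col (L v)))"
    by (simp_all only: nearest_exit.simps(2)[of G L _ v] f Let_def case_prod_conv)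
  then show ?case
    using Suc[of ?l] Suc[of ?r] unfolding f by (auto split: if_splits)
qed simp

primrec descend :: "bool list \<Rightarrow> nat \<Rightarrow> nat" where
  "descend [] v = v"
| "descend (b # bs) v = descend bs (if b then left_child G L v else right_child G L v)"

primrec all_internal :: "nat \<Rightarrow> nat \<Rightarrow> bool" where
  "all_internal 0 v = True"
| "all_internal (Suc d) v = (internal G L v \<and> all_internal d (left_child G L v)
     \<and> all_internal d (right_child G L v))"

lemma all_internal_nearest: "d \<le> fst (nearest_exit G L d v) \<Longrightarrow> all_internal d v"
  by (induction d arbitrary: v) (auto simp: split_beta Let_def split: if_splits)

lemma descend_in_verts:
  "all_internal (length bs) v \<Longrightarrow> v \<in> verts G \<Longrightarrow> descend bs v \<in> verts G"
  by (induction bs arbitrary: v) (auto simp: children_edges)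

lemma parent_descend:
  "all_internal (length bs) v \<Longrightarrow> (parent G L ^^ length bs) (descend bs v) = v"
  by (induction bs arbitrary: v) (auto simp: parent_child)

text \<open>Two words of equal length leading to the same node agree, since a node has only one parent.
This holds even if the words wind around a directed cycle.\<close>
lemma descend_inj:
  assumes "length bs = length cs" "all_internal (length bs) v" "v \<in> verts G"
    "descend bs v = descend cs v"
  shows "bs = cs"
  using assms
proof (induction bs cs arbitrary: v rule: list_induct2)
  case (Cons b bs c cs)
  let ?w = "\<lambda>b. if b then left_child G L v else right_child G L v"
  have int: "internal G L v" "all_internal (length bs) (?w b)" "all_internal (length cs) (?w c)"
    using Cons.prems(1) Cons.hyps by auto
  have "?w b = ?w c"
    using parent_descend[OF int(2)] parent_descend[OF int(3)] Cons.prems(3) Cons.hyps by simp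
  then have "b = c" using children_distinct[OF Cons.prems(2) int(1)] by (auto split: if_splits)
  moreover have "?w b \<in> verts G" using children_edges[OF Cons.prems(2) int(1)] by simp
  ultimately show ?case using Cons.IH[of "?w b"] int Cons.prems(3) by simp
qed simp

text \<open>\<open>descend\<close> embeds the \<open>2 ^ d\<close> words of length \<open>d\<close>
  into the vertices.\<close>

lemma all_internal_card:
  assumes "all_internal d v" "v \<in> verts G"
  shows "2 ^ d \<le> card (verts G)"
proof -
  let ?W = "{bs :: bool list. set bs \<subseteq> UNIV \<and> length bs = d}"
  have "inj_on (\<lambda>bs. descend bs v) ?W"
    using descend_inj assms by (auto intro!: inj_onI)
  moreover have "(\<lambda>bs. descend bs v) ` ?W \<subseteq> verts G"
    using descend_in_verts assms by auto
  moreover have "finite (verts G)" using wf by (simp add: wf_graph_def)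
  ultimately have "card ?W \<le> card (verts G)" by (rule card_inj_on_le)
  moreover have "card ?W = 2 ^ d" by (subst card_lists_length_eq) auto
  ultimately show ?thesis by simp
qed

lemma nearest_exit_valid:
  assumes "card (verts G) < 2 ^ d"
  shows "leafcol_valid G L (\<lambda>v. snd (nearest_exit G L d v))"
  unfolding leafcol_valid_iff
proof
  fix v assume v: "v \<in> verts G"
  obtain e where d: "d = Suc e"
    using assms v wf by (cases d) (auto simp: wf_graph_def card_gt_0_iff)
  let ?f = "nearest_exit G L" and ?l = "left_child G L v" and ?r = "right_child G L v"
  \<comment> \<open>Otherwise the first \<open>d\<close> levels would be internal, which requires
    \<open>2 ^ d\<close> vertices.\<close>
  have lt: "fst (?f d v) < d"
    using assms all_internal_card[OF all_internal_nearest v, of d] by (meson not_le)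
  have "snd (?f d v) = snd (?f d ?l) \<or> snd (?f d v) = snd (?f d ?r)" if int: "internal G L v"
  proof -
    obtain m1 c1 m2 c2 where f: "?f e ?l = (m1, c1)" "?f e ?r = (m2, c2)"
      by (metis surj_pair)
    have "?f d v = (if m1 \<le> m2 then (Suc m1, c1) else (Suc m2, c2))"
      using int by (simp only: d nearest_exit.simps(2)[of G L _ v] f Let_def case_prod_conv if_True)
    \<comment> \<open>The chosen child has its exit strictly inside horizon \<open>e\<close>, so its
      results at \<open>e\<close> and at \<open>d\<close> coincide by stability.\<close>
    moreover have "Suc m < d \<longleftrightarrow> m < e" for m by (simp add: d)
    ultimately show ?thesis
      using lt nearest_exit_stable[of e ?l] nearest_exit_stable[of e ?r] unfolding f d[symmetric]
      by (auto split: if_splits)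
  qed
  moreover have "\<not> internal G L v \<Longrightarrow> snd (nearest_exit G L d v) = col (L v)"
    by (simp add: d)
  ultimately show "if internal G L v
     then snd (nearest_exit G L d v) = snd (nearest_exit G L d (left_child G L v)) \<or>
       snd (nearest_exit G L d v) = snd (nearest_exit G L d (right_child G L v))
     else snd (nearest_exit G L d v) = col (L v)" by simp
qed

end

section \<open>Logarithms and asymptotic upper bounds\<close>

definition log2_ceil :: "nat \<Rightarrow> nat" where
  "log2_ceil n = nat \<lceil>log 2 (real n)\<rceil>"

lemma le_two_power_log2_ceil: "n \<le> 2 ^ log2_ceil n"
proof (cases "n = 0")
  case False
  have "real n = 2 powr (log 2 (real n))" using False by simp
  also have "\<dots> \<le> 2 powr (real (log2_ceil n))"
    unfolding log2_ceil_def by (intro powr_mono) linarith+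
  also have "\<dots> = real (2 ^ log2_ceil n)" by (simp add: powr_realpow)
  finally show ?thesis by linarith
qed simp

lemma log2_ceil_mono: "m \<le> n \<Longrightarrow> 1 \<le> m \<Longrightarrow> log2_ceil m \<le> log2_ceil n"
  unfolding log2_ceil_def by (intro nat_mono ceiling_mono) simp

lemma log2_ceil_le:
  assumes "n \<ge> 1" shows "real (log2_ceil n) \<le> log 2 (real n) + 1"
proof -
  have "log 2 (real n) \<ge> 0" using assms by simp
  then show ?thesis unfolding log2_ceil_def by linarith
qed

lemma alg_cost_le:
  assumes "\<And>G v. Inst G \<Longrightarrow> card (verts G) \<le> n \<Longrightarrow> v \<in> verts G \<Longrightarrow> C A G v \<le> c"
  shows "alg_cost C Inst A n \<le> c"
  unfolding alg_cost_def using assms by (intro SUP_least) auto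

lemma bigO_costI:
  assumes "0 < K" "\<And>n. N \<le> n \<Longrightarrow> c n \<le> enat (f n) \<and> real (f n) \<le> K * g n"
  shows "bigO_cost c g"
  unfolding bigO_cost_def
proof (intro exI conjI allI impI)
  fix n assume "N \<le> n"
  then have "c n \<le> enat (f n)" "real (f n) \<le> K * g n" using assms(2) by auto
  moreover from this(1) obtain k where "c n = enat k" "k \<le> f n" by (cases "c n") auto
  ultimately show "enat_le_real (c n) (K * g n)" by (auto simp: enat_le_real_def)
qed (rule assms(1))

lemma bigO_cost_lnI:
  assumes "\<And>n. 2 \<le> n \<Longrightarrow> c n \<le> enat (a * log2_ceil n + b)"
  shows "bigO_cost c (\<lambda>n. ln (real n))"
proof (rule bigO_costI)
  \<comment> \<open>For \<open>n\<close> at least 2, \<open>log 2 n\<close> is at least 1, so it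
    absorbs the rounding in \<open>log2_ceil\<close> (factor 2) and the constant \<open>b\<close>;
    the final 1 keeps the factor positive when \<open>a = b = 0\<close>.\<close>
  show "0 < (2 * real a + real b + 1) / ln 2" by simp
  fix n :: nat assume n: "2 \<le> n"
  have l: "1 \<le> log 2 (real n)" using n by simp
  have "real (log2_ceil n) \<le> 2 * log 2 (real n)" using log2_ceil_le[of n] n l by linarith
  then have "real a * real (log2_ceil n) \<le> real a * (2 * log 2 (real n))"
    by (intro mult_left_mono) auto
  moreover have "real b * 1 \<le> real b * log 2 (real n)" using l by (intro mult_left_mono) auto
  ultimately have "real (a * log2_ceil n + b) \<le> (2 * real a + real b + 1) * log 2 (real n)"
    using l by (simp add: algebra_simps)
  then show "c n \<le> enat (a * log2_ceil n + b) \<and>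
      real (a * log2_ceil n + b) \<le> (2 * real a + real b + 1) / ln 2 * ln (real n)"
    using assms[OF n] by (simp add: log_def)
qed

text \<open>The \<open>Suc\<close> makes \<open>2 ^ d\<close> strictly larger than \<open>n\<close>,
  as \<open>nearest_exit_valid\<close> demands.\<close>

definition nearest_alg :: "(tlab, color) alg" where
  "nearest_alg = alg_of (\<lambda>n ob.
     ask_nearest (\<lambda>x. x) (Suc (log2_ceil n)) (0, ob) (\<lambda>(m, c). Ret c))"

lemma
  assumes "D_inst \<Delta> \<alpha> G" "v \<in> verts G"
  shows halts_nearest_alg: "halts nearest_alg G v"
    and alg_output_nearest_alg: "alg_output nearest_alg G v =
      snd (nearest_exit G (inp G) (Suc (log2_ceil (card (verts G)))) v)"
    and visited_nearest_alg: "visited nearest_alg G v \<subseteq> near G v (log2_ceil (card (verts G)) + 2)"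
proof -
  interpret labeled_instance \<Delta> \<alpha> G "\<lambda>x. x"
    using assms(1) by unfold_locales (auto simp: D_inst_def)
  let ?d = "log2_ceil (card (verts G))"
  have "handle_of G [v] (0, obs G v) v" by (simp add: handle_of_def)
  from exec_ask_nearest[OF assms(2) this, of "Suc ?d" "\<lambda>(m, c). Ret c"]
  obtain ms where ms: "set ms \<subseteq> near G v (Suc (Suc ?d))"
    and e: "exec G [v] (ask_nearest (\<lambda>x. x) (Suc ?d) (0, obs G v) (\<lambda>(m, c). Ret c)) ([v] @ ms)
      (Ret (snd (nearest_exit G (inp G) (Suc ?d) v)))"
    unfolding split_beta by blast
  let ?P = "\<lambda>n ob. ask_nearest (\<lambda>x. x) (Suc (log2_ceil n)) (0, ob) (\<lambda>(m, c). Ret c)"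
  note run = halts_alg_of[where P = ?P, OF e] alg_output_alg_of[where P = ?P, OF e]
    visited_alg_of[where P = ?P, OF e]
  show "halts nearest_alg G v" "alg_output nearest_alg G v = snd (nearest_exit G (inp G) (Suc ?d) v)"
    unfolding nearest_alg_def by (rule run)+
  show "visited nearest_alg G v \<subseteq> near G v (?d + 2)"
    unfolding nearest_alg_def run(3) using ms near_refl by auto
qed

lemma D_solves_nearest_alg: "D_solves \<Delta> \<alpha> nearest_alg"
  unfolding D_solves_def
proof (intro allI impI conjI ballI)
  fix G :: "tlab lgraph" assume G: "D_inst \<Delta> \<alpha> G"
  then interpret tree_instance \<Delta> \<alpha> G "inp G" by unfold_locales (auto simp: D_inst_def)
  let ?d = "log2_ceil (card (verts G))"
  show "halts nearest_alg G v" if "v \<in> verts G" for v using halts_nearest_alg[OF G that] .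
  have lt: "card (verts G) < 2 ^ Suc ?d"
    using le_two_power_log2_ceil[of "card (verts G)"] by (simp add: less_le_trans[of _ "2 * 2 ^ ?d"] le_less_trans)
  have "alg_output nearest_alg G (left_child G (inp G) v) =
      snd (nearest_exit G (inp G) (Suc ?d) (left_child G (inp G) v))"
    "alg_output nearest_alg G (right_child G (inp G) v) =
      snd (nearest_exit G (inp G) (Suc ?d) (right_child G (inp G) v))"
    if "v \<in> verts G" "internal G (inp G) v" for v
    using children_edges(1,3)[OF that] by (simp_all del: nearest_exit.simps add: alg_output_nearest_alg[OF G])
  then show "leafcol_valid G (inp G) (alg_output nearest_alg G)"
    using nearest_exit_valid[OF lt] alg_output_nearest_alg[OF G]
    unfolding leafcol_valid_iff by (simp del: nearest_exit.simps)
qed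

lemma near_gdist: "w \<in> near G v d \<Longrightarrow> gdist G v w \<le> d"
  unfolding near_def by (blast intro: gdist_le le_trans)

lemma D_dist_upper:
  "bigO_cost (alg_cost dist_exec (D_inst \<Delta> \<alpha>) nearest_alg) (\<lambda>n. ln (real n))"
proof (rule bigO_cost_lnI)
  fix n :: nat assume "2 \<le> n"
  show "alg_cost dist_exec (D_inst \<Delta> \<alpha>) nearest_alg n \<le> enat (1 * log2_ceil n + 2)"
  proof (rule alg_cost_le)
    fix G :: "tlab lgraph" and v assume G: "D_inst \<Delta> \<alpha> G" "card (verts G) \<le> n" "v \<in> verts G"
    then have "card (verts G) \<ge> 1" by (auto simp: D_inst_def wf_graph_def Suc_le_eq card_gt_0_iff)
    then have "log2_ceil (card (verts G)) \<le> log2_ceil n" using G(2) by (rule log2_ceil_mono[rotated])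
    moreover have "gdist G v w \<le> log2_ceil (card (verts G)) + 2" if "w \<in> visited nearest_alg G v" for w
      using visited_nearest_alg[OF G(1,3)] that by (blast intro: near_gdist)
    ultimately have "gdist G v w \<le> 1 * log2_ceil n + 2" if "w \<in> visited nearest_alg G v" for w
      using that by fastforce
    then show "dist_exec nearest_alg G v \<le> enat (1 * log2_ceil n + 2)"
      using halts_nearest_alg[OF G(1,3)] by (auto simp: dist_exec_def intro!: SUP_least)
  qed
qed

text \<open>An execution cannot visit more than all vertices, so any correct algorithm has linear
  volume.\<close>

lemma D_vol_upper:
  assumes "D_solves \<Delta> \<alpha> A"
  shows "bigO_cost (alg_cost vol_exec (D_inst \<Delta> \<alpha>) A) (\<lambda>n. real n)"
proof (rule bigO_costI[of 1 0 _ "\<lambda>n. n"])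
  fix n :: nat
  have "alg_cost vol_exec (D_inst \<Delta> \<alpha>) A n \<le> enat n"
  proof (rule alg_cost_le)
    fix G :: "tlab lgraph" and v assume G: "D_inst \<Delta> \<alpha> G" "card (verts G) \<le> n" "v \<in> verts G"
    then have wf: "wf_graph \<Delta> \<alpha> G" by (simp add: D_inst_def)
    have "card (visited A G v) \<le> card (verts G)"
      using visited_subset_verts[OF wf G(3)] wf by (auto simp: wf_graph_def intro: card_mono)
    then show "vol_exec A G v \<le> enat n"
      using assms G by (auto simp: vol_exec_def D_solves_def)
  qed
  then show "alg_cost vol_exec (D_inst \<Delta> \<alpha>) A n \<le> enat n \<and> real n \<le> 1 * real n" by simp
qed simp

section \<open>The randomized algorithm\<close>

text \<open>The coin belongs to the node and is the same for all executions, so walks that meet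
  continue together.\<close>

definition coin_child :: "'i lgraph \<Rightarrow> (nat \<Rightarrow> tlab) \<Rightarrow> (nat \<Rightarrow> bool) \<Rightarrow> nat \<Rightarrow> nat" where
  "coin_child G L b v = (if b v then left_child G L v else right_child G L v)"

primrec walk_color :: "'i lgraph \<Rightarrow> (nat \<Rightarrow> tlab) \<Rightarrow> (nat \<Rightarrow> bool) \<Rightarrow> nat \<Rightarrow> nat \<Rightarrow> color" where
  "walk_color G L b 0 v = (if internal G L v then R else col (L v))"
| "walk_color G L b (Suc t) v =
     (if internal G L v then walk_color G L b t (coin_child G L b v) else col (L v))"

primrec exits_at :: "'i lgraph \<Rightarrow> (nat \<Rightarrow> tlab) \<Rightarrow> (nat \<Rightarrow> bool) \<Rightarrow> nat \<Rightarrow> nat \<Rightarrow> bool" where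
  "exits_at G L b 0 v \<longleftrightarrow> \<not> internal G L v"
| "exits_at G L b (Suc t) v \<longleftrightarrow> internal G L v \<and> exits_at G L b t (coin_child G L b v)"

text \<open>A walk that exits within \<open>t\<close> steps gives the same colour under both
  cut-offs; one still internal after \<open>t + 1\<close> steps answers \<open>R\<close> under
  both.\<close>

lemma walk_color_Suc:
  "\<not> exits_at G L b (Suc t) v \<Longrightarrow> walk_color G L b (Suc t) v = walk_color G L b t v"
proof (induction t arbitrary: v)
  case (Suc t)
  let ?w = "coin_child G L b v"
  have "walk_color G L b (Suc t) ?w = walk_color G L b t ?w" if "internal G L v"
    using Suc.IH[of ?w] Suc.prems that exits_at.simps(2)[of G L b "Suc t" v] by blast
  then show ?case
    using walk_color.simps(2)[of G L b t v] walk_color.simps(2)[of G L b "Suc t" v] by presburger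
qed auto

text \<open>Walks that have not exited after \<open>t\<close> steps all answer \<open>R\<close>, so they agree with each other; a
conflict arises only at a node whose walk exits at step \<open>t + 1\<close> exactly.\<close>
lemma walk_color_valid:
  assumes "\<And>v. v \<in> verts G \<Longrightarrow> \<not> exits_at G L b (Suc t) v"
  shows "leafcol_valid G L (walk_color G L b t)"
  unfolding leafcol_valid_iff
proof
  fix v assume "v \<in> verts G"
  \<comment> \<open>At an internal node the left side unfolds to the colour of the coin child with
    cut-off \<open>t\<close>, so this equation is the required constraint.\<close>
  then have "walk_color G L b (Suc t) v = walk_color G L b t v"
    using assms walk_color_Suc by blast
  moreover have "\<not> internal G L v \<Longrightarrow> walk_color G L b t v = col (L v)" by (cases t) auto
  ultimately show "if internal G L v
     then walk_color G L b t v = walk_color G L b t (left_child G L v) \<or>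
       walk_color G L b t v = walk_color G L b t (right_child G L v)
     else walk_color G L b t v = col (L v)"
    by (auto simp: coin_child_def split: if_splits)
qed

text \<open>With the coins fixed, the exit time depends only on the node. Hence a walk that exits
  never visits a node twice.\<close>

lemma exits_at_unique: "exits_at G L b s v \<Longrightarrow> exits_at G L b t v \<Longrightarrow> s = t"
proof (induction s arbitrary: t v)
  case 0 then show ?case by (cases t) auto
next
  case (Suc s) then show ?case by (cases t) auto
qed

lemma exits_at_iter:
  "exits_at G L b s v \<Longrightarrow> a \<le> s \<Longrightarrow> exits_at G L b (s - a) ((coin_child G L b ^^ a) v)"
proof (induction a)
  case (Suc a)
  then have "exits_at G L b (Suc (s - Suc a)) ((coin_child G L b ^^ a) v)"
    by (simp add: Suc_diff_Suc)
  then show ?case by simp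
qed simp

section \<open>Tracing a walk back from its exit\<close>

context tree_instance
begin

abbreviation ancestor :: "nat \<Rightarrow> nat \<Rightarrow> nat" where
  "ancestor i u \<equiv> (parent G L ^^ i) u"

text \<open>Distinctness of these ancestors makes their coins independent. The indices start at 1
  because the coin of the exit node itself does not influence the walk.\<close>

definition ancestor_path :: "nat \<Rightarrow> nat \<Rightarrow> bool" where
  "ancestor_path s u \<longleftrightarrow> inj_on (\<lambda>i. ancestor i u) {1..s} \<and> (\<lambda>i. ancestor i u) ` {1..s} \<subseteq> verts G"

text \<open>For fixed \<open>u\<close> the required value of each coin is determined by the graph,
  so this is a cylinder event.\<close>

definition coins_lead_to :: "nat \<Rightarrow> (nat \<Rightarrow> bool) \<Rightarrow> nat \<Rightarrow> bool" where
  "coins_lead_to s b u \<longleftrightarrow>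
     (\<forall>i\<in>{1..s}. b (ancestor i u) \<longleftrightarrow> left_child G L (ancestor i u) = ancestor (i - 1) u)"

text \<open>\<open>u\<close> is the node where the walk exits: each node of the walk is the parent
  of the next, so the ancestors of \<open>u\<close> are the walk in reverse, and they are distinct
  by \<open>exits_at_unique\<close>.\<close>

lemma exits_at_coins_lead_to:
  assumes ex: "exits_at G L b s v" and v: "v \<in> verts G"
  shows "\<exists>u\<in>verts G. ancestor_path s u \<and> coins_lead_to s b u"
proof -
  define x where "x a = (coin_child G L b ^^ a) v" for a
  have x_Suc: "x (Suc a) = coin_child G L b (x a)" for a by (simp add: x_def)
  have exa: "exits_at G L b (s - a) (x a)" if "a \<le> s" for a
    unfolding x_def using exits_at_iter[OF ex that] .
  have int: "internal G L (x a)" if "a < s" for a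
    using exa[of a] that by (cases "s - a") auto
  have xv: "x a \<in> verts G" if "a \<le> s" for a
    using that
  proof (induction a)
    case (Suc a)
    then show ?case using children_edges[OF _ int[of a]] by (simp add: x_Suc coin_child_def)
  qed (simp add: x_def v)
  have inj: "a = b" if "a \<le> s" "b \<le> s" "x a = x b" for a b
    using exits_at_unique[OF exa[OF that(1)], of "s - b"] exa[OF that(2)] that by simp
  have anc: "ancestor i (x s) = x (s - i)" if "i \<le> s" for i
    using that
  proof (induction i)
    case (Suc i)
    then have "parent G L (x (Suc (s - Suc i))) = x (s - Suc i)"
      using int[of "s - Suc i"] by (simp add: x_Suc coin_child_def parent_child)
    then show ?case using Suc by (simp add: Suc_diff_Suc)
  qed simp
  have "ancestor_path s (x s)"
    unfolding ancestor_path_def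
  proof (intro conjI inj_onI subsetI)
    fix i j assume "i \<in> {1..s}" "j \<in> {1..s}" "ancestor i (x s) = ancestor j (x s)"
    then have "s - i = s - j" using inj[of "s - i" "s - j"] by (simp add: anc)
    with \<open>i \<in> {1..s}\<close> \<open>j \<in> {1..s}\<close> show "i = j" unfolding atLeastAtMost_iff by arith
  qed (auto simp: anc xv)
  moreover have "coins_lead_to s b (x s)"
    unfolding coins_lead_to_def
  proof
    fix i assume i: "i \<in> {1..s}"
    then have si: "ancestor i (x s) = x (s - i)" "ancestor (i - 1) (x s) = coin_child G L b (x (s - i))"
      using anc[of i] anc[of "i - 1"] x_Suc[of "s - i"] by (auto simp: Suc_diff_le)
    have "left_child G L (x (s - i)) \<noteq> right_child G L (x (s - i))"
      using i by (intro children_distinct xv int) auto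
    then show "b (ancestor i (x s)) \<longleftrightarrow> left_child G L (ancestor i (x s)) = ancestor (i - 1) (x s)"
      unfolding si by (auto simp: coin_child_def)
  qed
  ultimately show ?thesis using xv[of s] by blast
qed

end

section \<open>Probability of coin cylinders and the union bound\<close>

interpretation coin_seq: prob_space coin_seq
  unfolding coin_seq_def by (intro prob_space_PiM measure_pmf.prob_space_axioms)

lemma prob_space_bitsM: "prob_space (bitsM V)"
  unfolding bitsM_def by (intro prob_space_PiM coin_seq.prob_space_axioms)

lemma first_coin_sets: "{\<omega> \<in> space coin_seq. \<omega> 0 = b} \<in> sets coin_seq"
  unfolding coin_seq_def by measurable

lemma measure_first_coin: "measure coin_seq {\<omega> \<in> space coin_seq. \<omega> 0 = b} = 1 / 2"
proof -
  interpret product_prob_space "\<lambda>_. measure_pmf (bernoulli_pmf (1/2))" "UNIV :: nat set"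
    by (simp add: product_prob_space_def product_sigma_finite_def product_prob_space_axioms_def
        measure_pmf.prob_space_axioms measure_pmf.sigma_finite_measure_axioms)
  have eq: "{\<omega> \<in> space coin_seq. \<omega> 0 = b} =
      prod_emb UNIV (\<lambda>_. measure_pmf (bernoulli_pmf (1/2))) {0} (Pi\<^sub>E {0} (\<lambda>_. {b}))"
    by (subst prod_emb_PiE) (auto simp: coin_seq_def space_PiM PiE_iff if_split_mem2)
  show ?thesis
    unfolding eq unfolding coin_seq_def by (subst measure_PiM_emb) (auto simp: measure_pmf_single)
qed

lemma
  fixes P :: "nat set"
  assumes "finite V" "P \<subseteq> V"
  shows coin_cylinder_sets: "{r \<in> space (bitsM V). \<forall>p\<in>P. r p 0 = s p} \<in> sets (bitsM V)"
    and measure_coin_cylinder: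
      "measure (bitsM V) {r \<in> space (bitsM V). \<forall>p\<in>P. r p 0 = s p} = (1 / 2) ^ card P"
proof -
  interpret product_prob_space "\<lambda>_::nat. coin_seq" V
    by (simp add: product_prob_space_def product_sigma_finite_def product_prob_space_axioms_def
        coin_seq.prob_space_axioms coin_seq.sigma_finite_measure_axioms)
  let ?X = "\<lambda>p. {\<omega> \<in> space coin_seq. \<omega> 0 = s p}"
  have P: "finite P" using assms finite_subset by blast
  have eq: "{r \<in> space (bitsM V). \<forall>p\<in>P. r p 0 = s p} =
      prod_emb V (\<lambda>_. coin_seq) P (Pi\<^sub>E P ?X)"
    using assms(2) sets.sets_into_space[OF first_coin_sets]
    by (subst prod_emb_PiE) (auto simp: bitsM_def space_PiM PiE_iff if_split_mem2 extensional_def)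
  show "{r \<in> space (bitsM V). \<forall>p\<in>P. r p 0 = s p} \<in> sets (bitsM V)"
    unfolding eq unfolding bitsM_def using assms(2) P first_coin_sets by (intro sets_PiM_I) auto
  show "measure (bitsM V) {r \<in> space (bitsM V). \<forall>p\<in>P. r p 0 = s p} = (1 / 2) ^ card P"
    unfolding eq unfolding bitsM_def using assms(2) P first_coin_sets
    by (subst measure_PiM_emb) (auto simp: measure_first_coin)
qed

context tree_instance
begin

definition bad_coins :: "nat \<Rightarrow> nat \<Rightarrow> (nat \<Rightarrow> nat \<Rightarrow> bool) set" where
  "bad_coins s u = {r \<in> space (bitsM (verts G)). coins_lead_to s (\<lambda>v. r v 0) u}"

lemma
  assumes "ancestor_path s u"
  shows bad_coins_sets: "bad_coins s u \<in> sets (bitsM (verts G))"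
    and measure_bad_coins: "measure (bitsM (verts G)) (bad_coins s u) = (1 / 2) ^ s"
proof -
  let ?I = "{1..s}" and ?f = "\<lambda>i. ancestor i u"
  have inj: "inj_on ?f ?I" and sub: "?f ` ?I \<subseteq> verts G"
    using assms by (auto simp: ancestor_path_def)
  have fin: "finite (verts G)" using wf by (simp add: wf_graph_def)
  \<comment> \<open>\<open>inv_into\<close> recovers the index of an ancestor from the node, turning
    the condition on indices into prescribed coins of nodes.\<close>
  define t where "t p = (left_child G L p = ancestor (inv_into ?I ?f p - 1) u)" for p
  have eq: "bad_coins s u = {r \<in> space (bitsM (verts G)). \<forall>p\<in>?f ` ?I. r p 0 = t p}"
    unfolding bad_coins_def coins_lead_to_def Set.ball_simps(9) t_def
    by (intro Collect_cong conj_cong ball_cong refl) (simp only: inv_into_f_f[OF inj])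
  show "bad_coins s u \<in> sets (bitsM (verts G))"
    unfolding eq by (rule coin_cylinder_sets[OF fin sub])
  show "measure (bitsM (verts G)) (bad_coins s u) = (1 / 2) ^ s"
    unfolding eq measure_coin_cylinder[OF fin sub] card_image[OF inj] by simp
qed

text \<open>A union bound over the exit nodes: the coins of a path leading to a given exit are
determined, because the path is traced back uniquely through the parents.\<close>
lemma no_walk_exits_at:
  defines "n \<equiv> card (verts G)"
  assumes "n\<^sup>2 \<le> 2 ^ s"
  shows "\<exists>S \<in> sets (bitsM (verts G)). S \<subseteq> space (bitsM (verts G)) \<and>
    (\<forall>r\<in>S. \<forall>v\<in>verts G. \<not> exits_at G L (\<lambda>v. r v 0) s v) \<and>
    measure (bitsM (verts G)) S \<ge> 1 - 1 / real n"
proof -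
  let ?M = "bitsM (verts G)"
  interpret M: prob_space ?M by (rule prob_space_bitsM)
  \<comment> \<open>The candidates for exits; there are at most \<open>n\<close>, each with
    probability \<open>(1 / 2) ^ s\<close>.\<close>
  define U where "U = {u \<in> verts G. ancestor_path s u}"
  have fin: "finite (verts G)" using wf by (simp add: wf_graph_def)
  then have U: "finite U" "card U \<le> n" by (auto simp: U_def n_def intro: card_mono)
  have sets: "bad_coins s u \<in> sets ?M" if "u \<in> U" for u using that by (auto simp: U_def bad_coins_sets)
  let ?B = "\<Union>u\<in>U. bad_coins s u"
  have B: "?B \<in> sets ?M" using sets U(1) by auto
  have "M.prob ?B \<le> (\<Sum>u\<in>U. M.prob (bad_coins s u))"
    using sets by (intro M.finite_measure_subadditive_finite U) auto
  also have "\<dots> = real (card U) * (1 / 2) ^ s" by (simp add: U_def measure_bad_coins)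
  also have "\<dots> \<le> real n * (1 / 2) ^ s" using U(2) by (intro mult_right_mono) auto
  \<comment> \<open>Here \<open>n\<^sup>2 \<le> 2 ^ s\<close> is used.\<close>
  also have "\<dots> \<le> 1 / real n"
  proof (cases "n = 0")
    case False
    have "real n * real n \<le> 2 ^ s"
      using assms(2) by (metis of_nat_mult of_nat_numeral of_nat_power of_nat_le_iff power2_eq_square)
    then show ?thesis using False by (simp add: field_simps)
  qed simp
  finally have "M.prob (space ?M - ?B) \<ge> 1 - 1 / real n" using B by (simp add: M.prob_compl)
  moreover have "\<not> exits_at G L (\<lambda>v. r v 0) s v" if "r \<in> space ?M - ?B" "v \<in> verts G" for r v
    using exits_at_coins_lead_to[of "\<lambda>v. r v 0" s v] that by (auto simp: U_def bad_coins_def)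
  ultimately show ?thesis using B by (intro bexI[of _ "space ?M - ?B"]) auto
qed

end

section \<open>The walk as a query program and its volume\<close>

primrec ask_walk :: "nat \<Rightarrow> (tlab \<times> (nat \<Rightarrow> bool)) handle \<Rightarrow> (tlab \<times> (nat \<Rightarrow> bool), color) prog" where
  "ask_walk 0 h = ask_children fst h (\<lambda>x. case x of
       None \<Rightarrow> Ret (col (label_of fst h)) | Some _ \<Rightarrow> Ret R)"
| "ask_walk (Suc t) h = ask_children fst h (\<lambda>x. case x of
       None \<Rightarrow> Ret (col (label_of fst h))
     | Some (a, b) \<Rightarrow> ask_walk t (if snd (snd (snd (snd h))) 0 then a else b))"

text \<open>At most \<open>Suc t\<close> nodes are tested, each with at most four queries.\<close>

lemma exec_ask_walk:
  assumes "labeled_instance \<Delta> \<alpha> H fst" "v \<in> verts H" "handle_of H ns h v"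
  shows "\<exists>ms. length ms \<le> 4 * Suc t \<and> exec H ns (ask_walk t h) (ns @ ms)
    (Ret (walk_color H (\<lambda>v. fst (inp H v)) (\<lambda>v. snd (inp H v) 0) t v))"
  using assms(2,3)
proof (induction t arbitrary: v ns h)
  case 0
  interpret labeled_instance \<Delta> \<alpha> H fst by (rule assms(1))
  let ?k = "\<lambda>x. case x of None \<Rightarrow> Ret (col (label_of fst h)) | Some _ \<Rightarrow> Ret R"
  obtain ms r where 1: "length ms \<le> 4" "exec H ns (ask_children fst h ?k) (ns @ ms) (?k r)"
    "internal H lab v \<Longrightarrow> \<exists>a b. r = Some (a, b) \<and>
       handle_of H (ns @ ms) a (left_child H lab v) \<and> handle_of H (ns @ ms) b (right_child H lab v)"
    "\<not> internal H lab v \<Longrightarrow> r = None"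
    by (rule exec_ask_children[OF 0, of ?k]) blast
  have k: "?k r = Ret (walk_color H lab (\<lambda>v. snd (inp H v) 0) 0 v)"
    using 1(3,4) label_of_handle[OF 0(2)] by auto
  have "exec H ns (ask_walk 0 h) (ns @ ms) (Ret (walk_color H lab (\<lambda>v. snd (inp H v) 0) 0 v))"
    unfolding ask_walk.simps by (rule 1(2)[unfolded k])
  then show ?case using 1(1) by (intro exI[of _ ms] conjI) simp_all
next
  case (Suc t)
  interpret labeled_instance \<Delta> \<alpha> H fst by (rule assms(1))
  let ?b = "\<lambda>v. snd (inp H v) 0"
  let ?k = "\<lambda>x. case x of None \<Rightarrow> Ret (col (label_of fst h))
     | Some (a, b) \<Rightarrow> ask_walk t (if snd (snd (snd (snd h))) 0 then a else b)"
  obtain ms r where 1: "length ms \<le> 4" "exec H ns (ask_children fst h ?k) (ns @ ms) (?k r)"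
    "internal H lab v \<Longrightarrow> \<exists>a b. r = Some (a, b) \<and>
       handle_of H (ns @ ms) a (left_child H lab v) \<and> handle_of H (ns @ ms) b (right_child H lab v)"
    "\<not> internal H lab v \<Longrightarrow> r = None"
    by (rule exec_ask_children[OF Suc.prems, of ?k]) blast
  show ?case
  proof (cases "internal H lab v")
    case False
    then show ?thesis using 1(1,2,4) label_of_handle[OF Suc.prems(2)] by (auto intro!: exI[of _ ms])
  next
    case True
    then obtain a b where ab: "r = Some (a, b)" "handle_of H (ns @ ms) a (left_child H lab v)"
      "handle_of H (ns @ ms) b (right_child H lab v)" using 1(3) by blast
    have coin: "snd (snd (snd (snd h))) 0 = ?b v"
      using Suc.prems(2) by (simp add: handle_of_def obs_def)
    let ?w = "coin_child H lab ?b v" and ?c = "if ?b v then a else b"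
    have "?w \<in> verts H" using children_edges[OF Suc.prems(1) True] by (simp add: coin_child_def)
    moreover have "handle_of H (ns @ ms) ?c ?w" using ab by (simp add: coin_child_def)
    ultimately obtain ms' where ms': "length ms' \<le> 4 * Suc t"
      "exec H (ns @ ms) (ask_walk t ?c) ((ns @ ms) @ ms') (Ret (walk_color H lab ?b t ?w))"
      using Suc.IH by blast
    have "exec H ns (ask_walk (Suc t) h) (ns @ ms) (ask_walk t ?c)"
      using 1(2) unfolding ask_walk.simps ab(1) option.case prod.case coin .
    then have "exec H ns (ask_walk (Suc t) h) (ns @ (ms @ ms')) (Ret (walk_color H lab ?b (Suc t) v))"
      using exec_trans ms'(2) True by fastforce
    then show ?thesis using 1(1) ms'(1) by (intro exI[of _ "ms @ ms'"]) auto
  qed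
qed

text \<open>The factor 2 brings the probability per exit down to \<open>1 / n\<^sup>2\<close>, which
  leaves \<open>1 / n\<close> after the union bound.\<close>

definition walk_alg :: "(tlab \<times> (nat \<Rightarrow> bool), color) alg" where
  "walk_alg = alg_of (\<lambda>n ob. ask_walk (2 * log2_ceil n) (0, ob))"

lemma R_inst_labeled: "R_inst \<Delta> \<alpha> H \<Longrightarrow> labeled_instance \<Delta> \<alpha> H fst"
  by unfold_locales (auto simp: R_inst_def comp_def)

lemma
  assumes "R_inst \<Delta> \<alpha> H" "v \<in> verts H"
  shows halts_walk_alg: "halts walk_alg H v"
    and alg_output_walk_alg: "alg_output walk_alg H v =
      walk_color H (\<lambda>v. fst (inp H v)) (\<lambda>v. snd (inp H v) 0) (2 * log2_ceil (card (verts H))) v"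
    and card_visited_walk_alg: "card (visited walk_alg H v) \<le> 8 * log2_ceil (card (verts H)) + 5"
proof -
  let ?t = "2 * log2_ceil (card (verts H))"
  have "handle_of H [v] (0, obs H v) v" by (simp add: handle_of_def)
  from exec_ask_walk[OF R_inst_labeled[OF assms(1)] assms(2) this, of ?t]
  obtain ms where ms: "length ms \<le> 4 * Suc ?t"
    and e: "exec H [v] (ask_walk ?t (0, obs H v)) ([v] @ ms)
      (Ret (walk_color H (\<lambda>v. fst (inp H v)) (\<lambda>v. snd (inp H v) 0) ?t v))"
    by blast
  let ?P = "\<lambda>n ob. ask_walk (2 * log2_ceil n) (0, ob)"
  note run = halts_alg_of[where P = ?P, OF e] alg_output_alg_of[where P = ?P, OF e]
    visited_alg_of[where P = ?P, OF e]
  show "halts walk_alg H v" "alg_output walk_alg H v =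
      walk_color H (\<lambda>v. fst (inp H v)) (\<lambda>v. snd (inp H v) 0) ?t v"
    unfolding walk_alg_def by (rule run)+
  \<comment> \<open>\<open>4 * (2 * l + 1)\<close> queries for \<open>l = log2_ceil n\<close>, and
    the start node.\<close>
  have "card (set ([v] @ ms)) \<le> length ([v] @ ms)" by (rule card_length)
  then show "card (visited walk_alg H v) \<le> 8 * log2_ceil (card (verts H)) + 5"
    unfolding walk_alg_def run(3) using ms by simp
qed

lemma R_vol_upper:
  "bigO_cost (alg_cost vol_exec (R_inst \<Delta> \<alpha>) walk_alg) (\<lambda>n. ln (real n))"
proof (rule bigO_cost_lnI)
  fix n :: nat assume "2 \<le> n"
  show "alg_cost vol_exec (R_inst \<Delta> \<alpha>) walk_alg n \<le> enat (8 * log2_ceil n + 5)"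
  proof (rule alg_cost_le)
    fix H :: "(tlab \<times> (nat \<Rightarrow> bool)) lgraph" and v
    assume H: "R_inst \<Delta> \<alpha> H" "card (verts H) \<le> n" "v \<in> verts H"
    then have "card (verts H) \<ge> 1" by (auto simp: R_inst_def wf_graph_def Suc_le_eq card_gt_0_iff)
    then have "log2_ceil (card (verts H)) \<le> log2_ceil n" using H(2) by (rule log2_ceil_mono[rotated])
    then show "vol_exec walk_alg H v \<le> enat (8 * log2_ceil n + 5)"
      using halts_walk_alg[OF H(1,3)] card_visited_walk_alg[OF H(1,3)] by (simp add: vol_exec_def)
  qed
qed

text \<open>Lets the walk serve both randomized upper bounds, and the distance lower bound both
  randomized lower bounds.\<close>

lemma R_dist_le_vol: "alg_cost dist_exec (R_inst \<Delta> \<alpha>) A n \<le> alg_cost vol_exec (R_inst \<Delta> \<alpha>) A n"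
  unfolding alg_cost_def
  by (intro SUP_mono) (auto simp: R_inst_def intro!: bexI SUP_mono dist_exec_le_vol_exec)

section \<open>Correctness of the randomized algorithm\<close>

lemma with_bits_simps [simp]:
  "verts (with_bits G r) = verts G" "deg (with_bits G r) = deg G" "port (with_bits G r) = port G"
  "ident (with_bits G r) = ident G" "inp (with_bits G r) = (\<lambda>u. (inp G u, r u))"
  by (simp_all add: with_bits_def)

lemma R_inst_with_bits: "D_inst \<Delta> \<alpha> G \<Longrightarrow> R_inst \<Delta> \<alpha> (with_bits G r)"
  by (simp add: D_inst_def R_inst_def wf_graph_def wf_tree_lab_def comp_def)

lemma internal_with_bits [simp]: "internal (with_bits G r) L = internal G L"
  by (simp add: fun_eq_iff internal_def points_def)

lemma exits_at_with_bits [simp]: "exits_at (with_bits G r) L b t = exits_at G L b t"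
proof
  fix v show "exits_at (with_bits G r) L b t v = exits_at G L b t v"
    by (induction t arbitrary: v) (simp_all add: coin_child_def left_child_def right_child_def)
qed

lemma R_solves_walk_alg: "R_solves \<Delta> \<alpha> walk_alg"
  unfolding R_solves_def
proof (intro exI[of _ 1] allI impI)
  fix G :: "tlab lgraph" assume G: "D_inst \<Delta> \<alpha> G"
  then interpret tree_instance \<Delta> \<alpha> G "inp G" by unfold_locales (auto simp: D_inst_def)
  let ?n = "card (verts G)" and ?M = "bitsM (verts G)"
  let ?t = "2 * log2_ceil ?n"
  have "?n\<^sup>2 \<le> (2 ^ log2_ceil ?n)\<^sup>2" by (intro power_mono le_two_power_log2_ceil) simp
  also have "\<dots> \<le> 2 ^ Suc ?t" by (simp add: power_mult[symmetric] mult.commute)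
  finally obtain S where S: "S \<in> sets ?M" "S \<subseteq> space ?M" "measure ?M S \<ge> 1 - 1 / real ?n"
    "\<And>r v. r \<in> S \<Longrightarrow> v \<in> verts G \<Longrightarrow> \<not> exits_at G (inp G) (\<lambda>v. r v 0) (Suc ?t) v"
    using no_walk_exits_at[of "Suc ?t"] by blast
  have "R_success walk_alg G r" if r: "r \<in> S" for r
  proof -
    let ?H = "with_bits G r"
    interpret H: tree_instance \<Delta> \<alpha> ?H "inp G"
      using R_inst_with_bits[OF G, of r] by unfold_locales (auto simp: R_inst_def comp_def)
    have RH: "R_inst \<Delta> \<alpha> ?H" by (rule R_inst_with_bits[OF G])
    have out: "alg_output walk_alg ?H v = walk_color ?H (inp G) (\<lambda>v. r v 0) ?t v" if "v \<in> verts G" for v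
      using alg_output_walk_alg[OF RH, of v] that by simp
    have "leafcol_valid ?H (inp G) (walk_color ?H (inp G) (\<lambda>v. r v 0) ?t)"
      by (rule walk_color_valid) (use S(4)[OF r] in \<open>simp del: exits_at.simps\<close>)
    then have "leafcol_valid ?H (inp G) (alg_output walk_alg ?H)"
      \<comment> \<open>The output is known on vertices only, so the children must be shown to be
        vertices.\<close>
      unfolding leafcol_valid_iff using out H.children_edges by (simp del: walk_color.simps)
    then show ?thesis using halts_walk_alg[OF RH] by (simp add: R_success_def comp_def)
  qed
  then show "\<exists>S\<in>sets ?M. S \<subseteq> {r \<in> space ?M. R_success walk_alg G r} \<and> 1 - 1 / real ?n \<le> measure ?M S"
    using S(1-3) by (intro bexI[of _ S]) auto
qed

section \<open>Trees in heap numbering\<close>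

text \<open>Nodes are numbered as in a binary heap: \<open>v\<close> has children \<open>2 v\<close>, \<open>2 v + 1\<close> and parent
\<open>v div 2\<close>. Node \<open>0\<close> is an inconsistent node above the root \<open>1\<close>, which makes all internal nodes look
alike. \<open>W\<close> is the set of internal nodes; the nodes of \<open>V\<close> outside the tree are isolated.\<close>
definition heap_tree :: "nat set \<Rightarrow> (nat \<Rightarrow> nat) \<Rightarrow> color \<Rightarrow> nat set \<Rightarrow> tlab lgraph" where
  "heap_tree W f c V = \<lparr>verts = V,
     deg = (\<lambda>v. if v \<in> W then 3 else if v = 0 \<or> v div 2 \<in> W then 1 else 0),
     port = (\<lambda>v j. if v = 0 then 1 else if j = 1 then v div 2 else if j = 2 then 2 * v else 2 * v + 1),
     ident = f,
     inp = (\<lambda>v. if v \<in> W then \<lparr>par = Some 1, lc = Some 2, rc = Some 3, col = R\<rparr>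
       else if v div 2 \<in> W then \<lparr>par = Some 1, lc = None, rc = None, col = c\<rparr>
       else \<lparr>par = None, lc = None, rc = None, col = R\<rparr>)\<rparr>"

definition tree_nodes :: "nat set \<Rightarrow> nat set" where
  "tree_nodes W = {0} \<union> W \<union> {v. v div 2 \<in> W}"

text \<open>The root is exempt because its parent in the numbering, \<open>1 div 2 = 0\<close>, is
  not an internal node.\<close>

definition parent_closed :: "nat set \<Rightarrow> bool" where
  "parent_closed W \<longleftrightarrow> (\<forall>w\<in>W. 2 \<le> w \<longrightarrow> w div 2 \<in> W)"

lemma verts_heap_tree [simp]: "verts (heap_tree W f c V) = V"
  and ident_heap_tree [simp]: "ident (heap_tree W f c V) = f"
  by (simp_all add: heap_tree_def)

lemma port_heap_tree: "port (heap_tree W f c V) v j =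
    (if v = 0 then 1 else if j = 1 then v div 2 else if j = 2 then 2 * v else 2 * v + 1)"
  by (simp add: heap_tree_def)

lemma deg_heap_tree: "deg (heap_tree W f c V) v =
    (if v \<in> W then 3 else if v = 0 \<or> v div 2 \<in> W then 1 else 0)"
  by (simp add: heap_tree_def)

lemma ports_1_3: "j \<in> {1..3::nat} \<longleftrightarrow> j = 1 \<or> j = 2 \<or> j = 3"
  by auto

text \<open>Internal nodes have degree 3, which is where \<Delta> \<ge> 3 enters; identifiers up to
  \<open>card V\<close> are admissible because \<alpha> \<ge> 1.\<close>

lemma wf_heap_tree:
  assumes "\<Delta> \<ge> 3" "\<alpha> \<ge> 1" and fin: "finite V" and V: "tree_nodes W \<subseteq> V"
    and W: "0 \<notin> W" "1 \<in> W" "parent_closed W"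
    and f: "inj_on f V" "f ` V \<subseteq> {1..card V}"
  shows "wf_graph \<Delta> \<alpha> (heap_tree W f c V)"
proof -
  let ?G = "heap_tree W f c V"
  have node: "v = 0 \<or> v \<in> W \<or> v div 2 \<in> W \<Longrightarrow> v \<in> V" for v
    using V by (auto simp: tree_nodes_def)
  have up: "v = 1 \<or> v div 2 \<in> W" if "v \<in> W" for v
    using W that unfolding parent_closed_def by (cases "v \<ge> 2") (auto simp: not_le less_2_cases_iff)
  have ports: "port ?G v j \<in> V \<and> port ?G v j \<noteq> v \<and>
      (\<exists>k\<in>{1..deg ?G (port ?G v j)}. port ?G (port ?G v j) k = v)" if j: "j \<in> {1..deg ?G v}" for v j
  proof -
    consider "v = 0" "j = 1" | "v \<in> W" "j = 1" "v = 1" | "v \<noteq> 0" "j = 1" "v div 2 \<in> W"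
      | "v \<in> W" "j = 2" | "v \<in> W" "j = 3"
      using j up[of v] W(1) ports_1_3[of j] by (auto simp: deg_heap_tree split: if_splits)
    then show ?thesis
    proof cases
      case 1
      then show ?thesis using W node[of 1] by (auto simp: port_heap_tree deg_heap_tree intro!: bexI[of _ 1])
    next
      case 2
      then show ?thesis using W node[of 0] by (auto simp: port_heap_tree deg_heap_tree intro!: bexI[of _ 1])
    next
      case 3
      then have "v div 2 \<noteq> 0" using W(1) by metis
      then have "v div 2 \<in> V" "v div 2 \<noteq> v" using 3 node by auto
      \<comment> \<open>The parity of \<open>v\<close> tells through which of its ports the parent
        reaches \<open>v\<close>.\<close>
      moreover have "port ?G (v div 2) (if even v then 2 else 3) = v"
        using 3 \<open>v div 2 \<noteq> 0\<close> by (auto simp: port_heap_tree)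
      moreover have "(if even v then 2 else 3) \<in> {1..deg ?G (v div 2)}" using 3 by (simp add: deg_heap_tree)
      moreover have up: "port ?G v j = v div 2" using 3 by (simp add: port_heap_tree)
      ultimately show ?thesis unfolding up by (intro conjI bexI)
    next
      case 4
      then have "v \<noteq> 0" using W(1) by metis
      then show ?thesis using 4 node[of "2 * v"]
        by (auto simp: port_heap_tree deg_heap_tree intro!: bexI[of _ 1])
    next
      case 5
      then have "v \<noteq> 0" using W(1) by metis
      then show ?thesis using 5 node[of "2 * v + 1"]
        by (auto simp: port_heap_tree deg_heap_tree intro!: bexI[of _ 1])
    qed
  qed
  have inj: "inj_on (port ?G v) {1..deg ?G v}" for v
  proof (cases "v \<in> W")
    case True
    then have "v \<noteq> 0" using W(1) by metis
    then show ?thesis using True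
      by (auto simp: deg_heap_tree ports_1_3 inj_on_def port_heap_tree split: if_splits)
  qed (auto simp: deg_heap_tree inj_on_def)
  have "real (f v) \<le> real (card V) powr \<alpha>" if "v \<in> V" for v
  proof -
    have "f v \<in> {1..card V}" using f(2) that by blast
    then have "real (f v) \<le> real (card V) powr 1" "1 \<le> real (card V)" by auto
    then show ?thesis using powr_mono[of 1 \<alpha> "real (card V)"] assms(2) by linarith
  qed
  moreover have "1 \<le> f v" if "v \<in> V" for v using f(2) that by (auto simp: image_subset_iff)
  ultimately show ?thesis
    unfolding wf_graph_def verts_heap_tree ident_heap_tree
    using fin f(1) ports inj assms(1) by (auto simp: deg_heap_tree simp del: One_nat_def)
qed

lemma D_inst_heap_tree:
  assumes "\<Delta> \<ge> 3" "\<alpha> \<ge> 1" "finite V" "tree_nodes W \<subseteq> V" "0 \<notin> W" "1 \<in> W" "parent_closed W"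
    "inj_on f V" "f ` V \<subseteq> {1..card V}"
  shows "D_inst \<Delta> \<alpha> (heap_tree W f c V)"
  using wf_heap_tree[OF assms] by (auto simp: D_inst_def wf_tree_lab_def heap_tree_def)

text \<open>Consider the largest internal node with a colour other than \<open>c\<close>. Its
  children have larger numbers, so each is a correctly coloured internal node or a leaf, and both
  have colour \<open>c\<close>.\<close>

lemma heap_tree_forced:
  assumes "finite W" "tree_nodes W \<subseteq> V" "0 \<notin> W" "w \<in> W"
    and val: "leafcol_valid (heap_tree W f c V) (inp (heap_tree W f c V)) chi"
  shows "chi w = c"
proof (rule ccontr)
  let ?G = "heap_tree W f c V"
  assume "chi w \<noteq> c"
  define X where "X = {v \<in> W. chi v \<noteq> c}"
  define x where "x = Max X"
  have X: "finite X" "X \<noteq> {}" using \<open>chi w \<noteq> c\<close> assms(1,4) by (auto simp: X_def)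
  then have "x \<in> X" unfolding x_def by (rule Max_in)
  then have xW: "x \<in> W" "chi x \<noteq> c" by (simp_all add: X_def)
  then have "x \<noteq> 0" using assms(3) by metis
  note x = xW this
  have int: "internal ?G (inp ?G) v \<longleftrightarrow> v \<in> W" for v
    using assms(3) by (cases "v = 0") (auto simp: internal_def points_def heap_tree_def)
  have child: "chi u = c" if "u div 2 = x" "u > x" for u
  proof (cases "u \<in> W")
    case True
    then show ?thesis using Max_ge[OF X(1), of u] that(2) by (auto simp: X_def x_def)
  next
    case False
    have "u \<in> V" using that(1) x(1) assms(2) by (auto simp: tree_nodes_def)
    then have "chi u = col (inp ?G u)" using val False int unfolding leafcol_valid_iff by simp
    then show ?thesis using False that(1) x(1) by (simp add: heap_tree_def)
  qed
  have "x \<in> V" using x(1) assms(2) by (auto simp: tree_nodes_def)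
  then have "chi x = chi (2 * x) \<or> chi x = chi (2 * x + 1)"
    using val x(1,3) int unfolding leafcol_valid_iff
    by (auto simp: left_child_def right_child_def heap_tree_def)
  then show False using child[of "2 * x"] child[of "2 * x + 1"] x by auto
qed

lemma alg_cost_ge:
  "Inst G \<Longrightarrow> card (verts G) \<le> n \<Longrightarrow> v \<in> verts G \<Longrightarrow> c \<le> C A G v \<Longrightarrow> c \<le> alg_cost C Inst A n"
  unfolding alg_cost_def by (auto intro!: SUP_upper2[of G] SUP_upper2[of v])

lemma real_le_enatI: "enat k \<le> c \<Longrightarrow> r \<le> real k \<Longrightarrow> real_le_enat r c"
  by (cases c) (auto simp: real_le_enat_def)

section \<open>The distance lower bound\<close>

text \<open>The leaves are the nodes from \<open>2 ^ k\<close> on; with node 0 there are exactly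
  \<open>2 ^ Suc k\<close> vertices. \<open>Suc\<close> keeps identifiers positive.\<close>

definition complete_tree :: "nat \<Rightarrow> color \<Rightarrow> tlab lgraph" where
  "complete_tree k c = heap_tree {1..<2 ^ k} Suc c {..<2 ^ Suc k}"

lemma tree_nodes_complete: "tree_nodes {1..<2 ^ k} \<subseteq> {..<2 ^ Suc k}"
proof
  fix v :: nat assume "v \<in> tree_nodes {1..<2 ^ k}"
  then have "v = 0 \<or> v < 2 ^ k \<or> v div 2 < 2 ^ k" by (auto simp: tree_nodes_def)
  then show "v \<in> {..<2 ^ Suc k}" by (auto simp: div_less_iff_less_mult less_le_trans[of v "2 ^ k"])
qed

lemma D_inst_complete_tree:
  assumes "\<Delta> \<ge> 3" "\<alpha> \<ge> 1" "k \<ge> 1" shows "D_inst \<Delta> \<alpha> (complete_tree k c)"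
proof -
  have "(1::nat) < 2 ^ k" using assms(3) by (intro one_less_power) auto
  then show ?thesis
    unfolding complete_tree_def using assms(1,2) tree_nodes_complete
    by (intro D_inst_heap_tree) (auto simp: parent_closed_def)
qed

lemma root_in_complete_tree: "1 \<in> verts (complete_tree k c)"
  using one_less_power[of "2::nat" "Suc k"] by (simp add: complete_tree_def)

lemma complete_tree_forced:
  assumes "k \<ge> 1" "leafcol_valid (complete_tree k c) (inp (complete_tree k c)) chi"
  shows "chi 1 = c"
proof -
  have "(1::nat) < 2 ^ k" using assms(1) by (intro one_less_power) auto
  then show ?thesis
    using heap_tree_forced[OF _ tree_nodes_complete _ _ assms(2)[unfolded complete_tree_def], of 1] by simp
qed

lemma agree_complete_tree: "agree_on {..<2 ^ k} (complete_tree k c) (complete_tree k c')"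
  by (auto simp: agree_on_def complete_tree_def obs_def heap_tree_def)

lemma edges_complete_tree: "(u, w) \<in> edges (complete_tree k c) \<Longrightarrow> w \<le> 2 * u + 1"
  by (auto simp: edges_def complete_tree_def port_heap_tree split: if_splits)

text \<open>Within distance \<open>< k\<close> of the root there are only nodes \<open>< 2 ^ k\<close>, that is, no leaves.\<close>
lemma dist_exec_ge:
  assumes wf: "wf_graph \<Delta> \<alpha> G" and v: "1 \<in> verts G"
    and edges: "\<And>u w. (u, w) \<in> edges G \<Longrightarrow> w \<le> 2 * u + 1"
    and agree: "agree_on {..<2 ^ k} G G'"
    and out: "alg_output A G 1 \<noteq> alg_output A G' 1"
  shows "enat k \<le> dist_exec A G 1"
proof -
  \<comment> \<open>Different outputs force the execution to leave the region where the two graphs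
    agree.\<close>
  have "\<not> visited A G 1 \<subseteq> {..<2 ^ k}"
    using alg_output_agree agree_on_subset[OF agree] out by metis
  then obtain w where w: "w \<in> visited A G 1" "2 ^ k \<le> w" by (meson lessThan_iff not_le subsetI)
  then obtain d where "(1, w) \<in> edges G ^^ d"
    using seen_walk_length[OF wf v] unfolding visited_eq_seen by blast
  then have walk: "(1, w) \<in> edges G ^^ gdist G 1 w" by (rule gdist_walk)
  \<comment> \<open>An edge leads from \<open>u\<close> at most to \<open>2 * u + 1\<close>, so each
    step at most doubles the range of reachable numbers.\<close>
  have "x < 2 ^ Suc e" if "(1, x) \<in> edges G ^^ e" for x e
    using that
  proof (induction e arbitrary: x)
    case (Suc e)
    then obtain y where "(1, y) \<in> edges G ^^ e" "(y, x) \<in> edges G" by auto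
    then show ?case using Suc.IH[of y] edges[of y x] by simp
  qed simp
  from this[OF walk] w(2) have "(2::nat) ^ k < 2 ^ Suc (gdist G 1 w)" by (rule le_less_trans[rotated])
  then have "k < Suc (gdist G 1 w)" by (rule power_less_imp_less_exp[rotated]) simp
  then have "enat k \<le> enat (gdist G 1 w)" by simp
  also have "\<dots> \<le> (SUP w\<in>visited A G 1. enat (gdist G 1 w))" using w(1) by (rule SUP_upper)
  finally show ?thesis by (simp add: dist_exec_def)
qed

text \<open>Instances exist only for sizes \<open>2 ^ Suc k\<close>; a general \<open>n\<close> uses
  the largest power of two below or equal to it.\<close>

lemma bigOmega_lnI:
  assumes "\<And>k n. k0 \<le> k \<Longrightarrow> 2 ^ Suc k \<le> n \<Longrightarrow> enat k \<le> c n"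
  shows "bigOmega_cost c (\<lambda>n. ln (real n))"
  unfolding bigOmega_cost_def
proof (intro exI conjI allI impI)
  show "(0::real) < 1 / 2" by simp
  \<comment> \<open>The 3 yields \<open>k0 \<le> k\<close> and \<open>2 \<le> k\<close>; the latter
    gives \<open>k + 2 \<le> 2 * k\<close>, which compensates for rounding.\<close>
  fix n :: nat assume n: "2 ^ (k0 + 3) \<le> n"
  then have "1 \<le> n" by (metis le_trans one_le_numeral one_le_power)
  then obtain m where m: "2 ^ m \<le> n" "n < 2 ^ (m + 1)" using ex_power_ivl1[of 2 n] by auto
  have "(2::nat) ^ (k0 + 3) < 2 ^ (m + 1)" using n m(2) by linarith
  then have "k0 + 3 < m + 1" by (rule power_less_imp_less_exp[rotated]) simp
  then obtain k where k: "m = Suc k" "k0 \<le> k" "2 \<le> k" by (cases m) auto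
  have "real n \<le> 2 ^ (m + 1)" using m(2) by (metis less_imp_le of_nat_le_iff of_nat_numeral of_nat_power)
  then have "ln (real n) \<le> ln (2 ^ (m + 1))" using \<open>1 \<le> n\<close> by (subst ln_le_cancel_iff) auto
  also have "\<dots> = real (m + 1) * ln 2" by (rule ln_realpow)
  also have "\<dots> \<le> real (m + 1) * 1" using ln_2_less_1 by (intro mult_left_mono) auto
  finally have "1 / 2 * ln (real n) \<le> real k" using k by simp
  then show "real_le_enat (1 / 2 * ln (real n)) (c n)"
    using assms[of k n] k m(1) by (auto intro: real_le_enatI)
qed

lemma D_dist_lower:
  assumes "\<Delta> \<ge> 3" "\<alpha> \<ge> 1" and A: "D_solves \<Delta> \<alpha> A"
  shows "bigOmega_cost (alg_cost dist_exec (D_inst \<Delta> \<alpha>) A) (\<lambda>n. ln (real n))"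
proof (rule bigOmega_lnI)
  fix k n :: nat assume k: "1 \<le> k" and n: "2 ^ Suc k \<le> n"
  let ?G = "complete_tree k"
  have inst: "D_inst \<Delta> \<alpha> (?G c)" for c using D_inst_complete_tree assms(1,2) k .
  have out: "alg_output A (?G c) 1 = c" for c
    using complete_tree_forced[OF k] A inst by (auto simp: D_solves_def)
  have v: "1 \<in> verts (?G R)" by (rule root_in_complete_tree)
  have "enat k \<le> dist_exec A (?G R) 1"
    by (rule dist_exec_ge[where \<Delta> = \<Delta> and \<alpha> = \<alpha> and G' = "?G B"])
      (use inst v out in \<open>auto simp: D_inst_def agree_complete_tree dest: edges_complete_tree\<close>)
  then show "enat k \<le> alg_cost dist_exec (D_inst \<Delta> \<alpha>) A n"
    using inst v n by (intro alg_cost_ge[of _ "?G R" _ 1]) (auto simp: complete_tree_def)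
qed

lemma leafcol_valid_with_bits [simp]: "leafcol_valid (with_bits G r) L chi = leafcol_valid G L chi"
  by (simp add: leafcol_valid_iff left_child_def right_child_def)

lemma edges_with_bits [simp]: "edges (with_bits G r) = edges G"
  by (simp add: edges_def)

lemma agree_with_bits: "agree_on S G G' \<Longrightarrow> agree_on S (with_bits G r) (with_bits G' r)"
  by (auto simp: agree_on_def obs_def)

text \<open>The success events of the two colourings have probability above \<open>1/2\<close> each, so some
assignment of coins makes the algorithm succeed on both.\<close>
lemma R_dist_lower:
  assumes "\<Delta> \<ge> 3" "\<alpha> \<ge> 1" and A: "R_solves \<Delta> \<alpha> A"
  shows "bigOmega_cost (alg_cost dist_exec (R_inst \<Delta> \<alpha>) A) (\<lambda>n. ln (real n))"
proof -
  obtain c where c: "\<And>G. D_inst \<Delta> \<alpha> G \<Longrightarrow> \<exists>S\<in>sets (bitsM (verts G)).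
        S \<subseteq> {r \<in> space (bitsM (verts G)). R_success A G r} \<and>
        measure (bitsM (verts G)) S \<ge> 1 - c / real (card (verts G))"
    using A unfolding R_solves_def by blast
  \<comment> \<open>For \<open>k\<close> beyond \<open>k0\<close>, \<open>c < k < 2 ^ k\<close>, so
    the failure bound \<open>c / 2 ^ Suc k\<close> is below \<open>1 / 2\<close>.\<close>
  obtain k0 :: nat where k0: "c < real k0" using reals_Archimedean2 by blast
  show ?thesis
  proof (rule bigOmega_lnI[of "Suc k0"])
    fix k n :: nat assume k: "Suc k0 \<le> k" and n: "2 ^ Suc k \<le> n"
    let ?G = "complete_tree k" and ?M = "bitsM {..<2 ^ Suc k}"
    interpret M: prob_space ?M by (rule prob_space_bitsM)
    have inst: "D_inst \<Delta> \<alpha> (?G c)" for c using D_inst_complete_tree assms(1,2) k by simp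
    have V [simp]: "verts (?G c) = {..<2 ^ Suc k}" for c by (simp add: complete_tree_def)
    have "real k < 2 ^ k" by (rule of_nat_less_two_power)
    moreover have "real k0 \<le> real k" using k by simp
    ultimately have "c < 2 ^ k" using k0 by linarith
    then have half: "c / real (card {..<2 ^ Suc k :: nat}) < 1 / 2"
      by (simp add: field_simps)
    have "\<exists>S\<in>sets ?M. S \<subseteq> {r. R_success A (?G x) r} \<and> measure ?M S > 1 / 2" for x
    proof -
      obtain S where S: "S \<in> sets ?M" "S \<subseteq> {r \<in> space ?M. R_success A (?G x) r}"
        "measure ?M S \<ge> 1 - c / real (card {..<2 ^ Suc k :: nat})"
        using c[OF inst[of x]] unfolding V by (elim bexE conjE)
      have "S \<subseteq> {r. R_success A (?G x) r}" using S(2) by (rule order_trans) blast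
      moreover have "measure ?M S > 1 / 2" using S(3) half by linarith
      ultimately show ?thesis using S(1) by (intro bexI conjI)
    qed
    from this[of R] this[of B] obtain S1 S2
      where S1: "S1 \<in> sets ?M" "S1 \<subseteq> {r. R_success A (?G R) r}" "M.prob S1 > 1 / 2"
        and S2: "S2 \<in> sets ?M" "S2 \<subseteq> {r. R_success A (?G B) r}" "M.prob S2 > 1 / 2" by (elim bexE conjE)
    have "S1 \<inter> S2 \<noteq> {}"
    proof
      assume "S1 \<inter> S2 = {}"
      then have "M.prob (S1 \<union> S2) = M.prob S1 + M.prob S2"
        using S1(1) S2(1) by (intro M.finite_measure_Union) auto
      then show False using M.prob_le_1[of "S1 \<union> S2"] S1(3) S2(3) by linarith
    qed
    then obtain r where "r \<in> S1" "r \<in> S2" by blast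
    then have "R_success A (?G R) r" "R_success A (?G B) r" using S1(2) S2(2) by auto
    then have r: "R_success A (?G x) r" for x by (cases x) auto
    let ?H = "\<lambda>x. with_bits (?G x) r"
    have out: "alg_output A (?H x) 1 = x" for x
      using complete_tree_forced[of k x] k r[of x] by (simp add: R_success_def comp_def Let_def)
    have RH: "R_inst \<Delta> \<alpha> (?H x)" for x by (rule R_inst_with_bits[OF inst])
    have v: "1 \<in> verts (?H R)" using root_in_complete_tree[of k R] by simp
    have "enat k \<le> dist_exec A (?H R) 1"
      by (rule dist_exec_ge[where \<Delta> = \<Delta> and \<alpha> = \<alpha> and G' = "?H B"])
        (use RH out v in \<open>auto simp: R_inst_def intro!: agree_with_bits agree_complete_tree dest: edges_complete_tree\<close>)
    then show "enat k \<le> alg_cost dist_exec (R_inst \<Delta> \<alpha>) A n"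
      using RH n v by (intro alg_cost_ge[of _ "?H R" _ 1]) auto
  qed
qed

section \<open>The deterministic volume lower bound\<close>

text \<open>The infinite tree explored by the adversary; its vertex set only fixes the announced
number \<open>n\<close> of nodes.\<close>
definition infinite_tree :: "nat \<Rightarrow> (nat \<Rightarrow> nat) \<Rightarrow> tlab lgraph" where
  "infinite_tree n f = heap_tree {1..} f R {..<n}"

text \<open>Exploration starts at the root. A downward step comes from the parent, and an upward
  step reaches a node already known by closure, or node 0.\<close>

lemma seen_infinite_tree_closed: "parent_closed (seen A (infinite_tree n f) 1 k)"
proof (induction k)
  case (Suc k)
  let ?S = "seen A (infinite_tree n f) 1 k"
  show ?case
  proof (cases rule: seen_Suc_cases[of A "infinite_tree n f" 1 k])
    case (2 w j)
    let ?u = "port (infinite_tree n f) w j"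
    have "?u div 2 \<in> ?S" if u: "2 \<le> ?u"
    proof -
      have w: "w \<noteq> 0" using u by (cases "w = 0") (simp_all add: infinite_tree_def port_heap_tree)
      show ?thesis
      proof (cases "j = 1")
        case True
        then have eq: "?u = w div 2" using w by (simp add: infinite_tree_def port_heap_tree)
        then have "?u \<in> ?S" using Suc 2(1) u unfolding parent_closed_def by simp
        then show ?thesis using Suc u unfolding parent_closed_def by blast
      next
        case False
        then have "?u div 2 = w" using w by (simp add: infinite_tree_def port_heap_tree)
        then show ?thesis using 2(1) by simp
      qed
    qed
    then show ?thesis using Suc unfolding 2(3) parent_closed_def by blast
  qed (use Suc in simp)
qed (simp add: parent_closed_def)

text \<open>Identifiers are handed out in the order of discovery: as long as only \<open>m\<close> nodes are known,
re-labelling an undiscovered node with \<open>m + 1\<close> does not affect the execution.\<close>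
lemma adversary_run:
  fixes A :: "(tlab, color) alg"
  assumes "1 \<le> m"
  shows "\<exists>f S k. bij_betw f S {1..card S} \<and> S = seen A (infinite_tree n f) 1 k \<and>
    (card S = m \<or> card S < m \<and> S = visited A (infinite_tree n f) 1)"
  using assms
proof (induction m rule: dec_induct)
  case base
  show ?case
    by (intro exI[of _ "\<lambda>_. 1"] exI[of _ "{1}"] exI[of _ 0] conjI disjI1) (auto simp: bij_betw_def)
next
  case (step m)
  obtain f S k where f: "bij_betw f S {1..card S}" and k: "S = seen A (infinite_tree n f) 1 k"
    and alt: "card S = m \<or> card S < m \<and> S = visited A (infinite_tree n f) 1"
    using step.IH by blast
  let ?T = "infinite_tree n f"
  have fin: "finite S" by (simp add: k)
  show ?case
  proof (cases "visited A ?T 1 = S")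
    case True
    then show ?thesis using f alt k by (intro exI[of _ f] exI[of _ S] exI[of _ k]) auto
  next
    case False
    then have card: "card S = m" using alt by blast
    have ex: "\<exists>l. \<not> seen A ?T 1 l \<subseteq> S" using False k unfolding visited_eq_seen by blast
    \<comment> \<open>The first time at which the execution leaves \<open>S\<close>; it enters
      exactly one new node \<open>u\<close> then.\<close>
    define l where "l = (LEAST l. \<not> seen A ?T 1 l \<subseteq> S)"
    have l: "\<not> seen A ?T 1 l \<subseteq> S" "i < l \<Longrightarrow> seen A ?T 1 i \<subseteq> S" for i
      using LeastI_ex[OF ex] not_less_Least[of i "\<lambda>l. \<not> seen A ?T 1 l \<subseteq> S"] by (simp_all add: l_def)
    have "l \<noteq> 0" using l(1) start_in_seen[of 1 A ?T k] by (auto simp: k)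
    then obtain l' where l': "l = Suc l'" by (cases l) auto
    have "\<not> l \<le> k" using l(1) seen_mono[of l k A ?T 1] k by blast
    then have "S \<subseteq> seen A ?T 1 l'" unfolding k l' by (intro seen_mono) simp
    then have S: "seen A ?T 1 l' = S" using l(2)[of l'] l' by auto
    obtain u where u: "u \<notin> S" "seen A ?T 1 l = insert u S"
    proof (cases rule: seen_Suc_cases[of A ?T 1 l'])
      case 1
      then show ?thesis using l(1) S l' by simp
    next
      case (2 w j)
      let ?u = "port ?T w j"
      have eq: "seen A ?T 1 l = insert ?u S" using 2(3) unfolding S l' .
      then have "?u \<notin> S" using l(1) by auto
      then show ?thesis using eq by (rule that)
    qed
    define f' where "f' = f(u := Suc m)"
    \<comment> \<open>Agreement before the discovery of \<open>u\<close> suffices: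
      \<open>steps_agree\<close> reaches one step further, so \<open>u\<close> is still the node
      found, now with the fresh identifier.\<close>
    have "agree_on (seen A ?T 1 l') ?T (infinite_tree n f')"
      unfolding S using u(1) by (auto simp: agree_on_def infinite_tree_def obs_def heap_tree_def f'_def)
    then have "seen A (infinite_tree n f') 1 l = insert u S"
      using seen_agree[of A ?T 1 l' _ l] u(2) l' by simp
    moreover have "bij_betw f' (insert u S) {1..card (insert u S)}"
    proof -
      have "bij_betw f' S {1..m}"
        using f u(1) card by (subst bij_betw_cong[of S f' f]) (auto simp: f'_def)
      then have "bij_betw f' (S \<union> {u}) ({1..m} \<union> {f' u})"
        by (rule notIn_Un_bij_betw[OF u(1), rotated]) (simp add: f'_def)
      moreover have "{1..m} \<union> {f' u} = {1..Suc m}" by (auto simp: f'_def)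
      ultimately show ?thesis using u(1) card fin by simp
    qed
    ultimately show ?thesis using u(1) card fin
      by (intro exI[of _ f'] exI[of _ "insert u S"] exI[of _ l]) simp
  qed
qed

text \<open>By closure every node other than 0 and 1 is a child of a node in \<open>W\<close>, and
  each node has two children.\<close>

lemma card_tree_nodes:
  assumes "finite W" "parent_closed W"
  shows "finite (tree_nodes W)" "card (tree_nodes W) \<le> 2 + 2 * card W"
proof -
  let ?X = "{0, 1} \<union> ((\<lambda>w. 2 * w) ` W \<union> (\<lambda>w. 2 * w + 1) ` W)"
  have child: "v \<in> ?X" if "v div 2 \<in> W" for v
  proof -
    have "v = 2 * (v div 2) \<or> v = 2 * (v div 2) + 1" by presburger
    then show ?thesis using that by blast
  qed
  have "v \<in> ?X" if "v \<in> W" for v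
    using child[of v] that assms(2) unfolding parent_closed_def
    by (cases "2 \<le> v") (auto simp: not_le less_2_cases_iff)
  then have sub: "tree_nodes W \<subseteq> ?X" using child by (auto simp only: tree_nodes_def)
  have fin: "finite ?X" using assms(1) by simp
  show "finite (tree_nodes W)" using sub fin by (rule finite_subset)
  have "card (tree_nodes W) \<le> card ?X" using fin sub by (rule card_mono)
  also have "\<dots> \<le> card {0, 1::nat} + card ((\<lambda>w. 2 * w) ` W \<union> (\<lambda>w. 2 * w + 1) ` W)"
    by (rule card_Un_le)
  also have "\<dots> \<le> 2 + (card ((\<lambda>w. 2 * w) ` W) + card ((\<lambda>w. 2 * w + 1) ` W))"
    by (intro add_mono card_Un_le) simp
  also have "\<dots> \<le> 2 + (card W + card W)" by (intro add_mono card_image_le assms(1) order_refl)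
  finally show "card (tree_nodes W) \<le> 2 + 2 * card W" by simp
qed

text \<open>Cutting the infinite tree below the discovered nodes \<open>S\<close> and padding with isolated nodes
gives an \<open>n\<close>-node instance that looks the same on \<open>S\<close>.\<close>
lemma truncate_infinite_tree:
  assumes "\<Delta> \<ge> 3" "\<alpha> \<ge> 1" and S: "finite S" "1 \<in> S" "parent_closed S"
    and f: "bij_betw f S {1..card S}" and n: "2 + 2 * card S \<le> n"
  obtains G where "\<And>c. D_inst \<Delta> \<alpha> (G c)" "\<And>c. card (verts (G c)) = n" "\<And>c. 1 \<in> verts (G c)"
    "\<And>c. agree_on S (infinite_tree n f) (G c)"
    "\<And>c chi. leafcol_valid (G c) (inp (G c)) chi \<Longrightarrow> chi 1 = c"
proof -
  \<comment> \<open>Node 0 may have been discovered, but it is not internal in either tree.\<close>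
  define W where "W = S - {0}"
  have W: "finite W" "0 \<notin> W" "1 \<in> W" "parent_closed W"
    using S by (auto simp: W_def parent_closed_def)
  have "card W \<le> card S" unfolding W_def by (intro card_mono S) auto
  then have tn: "finite (tree_nodes W)" "card (tree_nodes W) \<le> n"
    using card_tree_nodes[OF W(1,4)] n by linarith+
  have "infinite (- tree_nodes W)" using tn(1) by (simp add: Compl_eq_Diff_UNIV)
  then obtain F where F: "finite F" "card F = n - card (tree_nodes W)" "F \<subseteq> - tree_nodes W"
    using infinite_arbitrarily_large by blast
  define V where "V = tree_nodes W \<union> F"
  have V: "finite V" "tree_nodes W \<subseteq> V" using tn(1) F(1) by (auto simp: V_def)
  have "card V = card (tree_nodes W) + card F"
    unfolding V_def using F tn(1) by (intro card_Un_disjoint) auto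
  then have cV: "card V = n" using F(2) tn(2) by simp
  have SV: "S \<subseteq> V" using V(2) by (auto simp: tree_nodes_def W_def)
  have "card (V - S) = card {card S + 1..n}" using cV SV S(1) by (simp add: card_Diff_subset)
  then obtain g where g: "bij_betw g (V - S) {card S + 1..n}"
    using finite_same_card_bij[of "V - S" "{card S + 1..n}"] V(1) by auto
  define h where "h v = (if v \<in> S then f v else g v)" for v
  have "bij_betw h S {1..card S}" using f by (subst bij_betw_cong[of S h f]) (auto simp: h_def)
  moreover have "bij_betw h (V - S) {card S + 1..n}"
    using g by (subst bij_betw_cong[of "V - S" h g]) (auto simp: h_def)
  ultimately have "bij_betw h (S \<union> (V - S)) ({1..card S} \<union> {card S + 1..n})"
    by (rule bij_betw_combine) auto
  then have h: "inj_on h V" "h ` V \<subseteq> {1..card V}"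
    using SV n cV by (auto simp: bij_betw_def Un_absorb1)
  show ?thesis
  proof (rule that[of "\<lambda>c. heap_tree W h c V"])
    fix c chi
    show "D_inst \<Delta> \<alpha> (heap_tree W h c V)"
      by (intro D_inst_heap_tree assms(1,2) V W h)
    show "card (verts (heap_tree W h c V)) = n" "1 \<in> verts (heap_tree W h c V)"
      using cV SV S(2) by auto
    show "agree_on S (infinite_tree n f) (heap_tree W h c V)"
      using cV by (auto simp: agree_on_def infinite_tree_def obs_def heap_tree_def h_def W_def)
    show "chi 1 = c" if "leafcol_valid (heap_tree W h c V) (inp (heap_tree W h c V)) chi"
      using heap_tree_forced[OF W(1) V(2) W(2,3) that] .
  qed
qed

text \<open>Either the adversary makes the algorithm discover \<open>m\<close> nodes, or the
  execution stays inside \<open>S\<close>. In the latter case it gives the same answer for both leaf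
  colours, although the root is forced to answer differently.\<close>

lemma D_vol_ge:
  assumes "\<Delta> \<ge> 3" "\<alpha> \<ge> 1" and A: "D_solves \<Delta> \<alpha> A" and m: "1 \<le> m" "2 + 2 * m \<le> n"
  shows "enat m \<le> alg_cost vol_exec (D_inst \<Delta> \<alpha>) A n"
proof -
  obtain f S k where f: "bij_betw f S {1..card S}" and k: "S = seen A (infinite_tree n f) 1 k"
    and alt: "card S = m \<or> card S < m \<and> S = visited A (infinite_tree n f) 1"
    using adversary_run[OF m(1), of A n] by blast
  have S: "finite S" "1 \<in> S" "parent_closed S" "2 + 2 * card S \<le> n"
    using alt m seen_infinite_tree_closed by (auto simp: k start_in_seen)
  obtain G where G: "\<And>c. D_inst \<Delta> \<alpha> (G c)" "\<And>c. card (verts (G c)) = n" "\<And>c. 1 \<in> verts (G c)"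
    "\<And>c. agree_on S (infinite_tree n f) (G c)"
    "\<And>c chi. leafcol_valid (G c) (inp (G c)) chi \<Longrightarrow> chi 1 = c"
    using truncate_infinite_tree[OF assms(1,2) S(1,2,3) f S(4)] by metis
  have out: "alg_output A (G c) 1 = c" for c
    using A G(1,5) by (simp add: D_solves_def)
  from alt show ?thesis
  proof
    assume "card S = m"
    have wf: "wf_graph \<Delta> \<alpha> (G R)" using G(1) by (simp add: D_inst_def)
    then have fin: "finite (visited A (G R) 1)"
      using visited_subset_verts[OF wf G(3)] unfolding wf_graph_def by (meson finite_subset)
    have "seen A (G R) 1 k = S"
      using seen_agree[of A "infinite_tree n f" 1 k "G R" k] G(4) unfolding k by simp
    then have "S \<subseteq> visited A (G R) 1" unfolding visited_eq_seen by blast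
    then have "m \<le> card (visited A (G R) 1)" using card_mono[OF fin] \<open>card S = m\<close> by blast
    then have "enat m \<le> vol_exec A (G R) 1" by (simp add: vol_exec_def)
    then show ?thesis using G(1,2,3) by (intro alg_cost_ge[of _ "G R" _ 1]) auto
  next
    assume "card S < m \<and> S = visited A (infinite_tree n f) 1"
    then have "alg_output A (G c) 1 = alg_output A (infinite_tree n f) 1" for c
      using alg_output_agree G(4) by metis
    then have "R = B" using out by metis
    then show ?thesis by simp
  qed
qed

lemma D_vol_lower:
  assumes "\<Delta> \<ge> 3" "\<alpha> \<ge> 1" "D_solves \<Delta> \<alpha> A"
  shows "bigOmega_cost (alg_cost vol_exec (D_inst \<Delta> \<alpha>) A) (\<lambda>n. real n)"
  unfolding bigOmega_cost_def
proof (intro exI conjI allI impI)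
  fix n :: nat assume "6 \<le> n"
  \<comment> \<open>The largest \<open>m\<close> allowed by \<open>D_vol_ge\<close>; from
    \<open>n = 6\<close> on it satisfies \<open>n \<le> 4 * m\<close>.\<close>
  define m where "m = (n - 2) div 2"
  have "1 \<le> m" "2 + 2 * m \<le> n" "n \<le> 4 * m" using \<open>6 \<le> n\<close> unfolding m_def by presburger+
  moreover from this(3) have "1 / 4 * real n \<le> real m" by simp
  ultimately show "real_le_enat (1 / 4 * real n) (alg_cost vol_exec (D_inst \<Delta> \<alpha>) A n)"
    using D_vol_ge[OF assms] by (blast intro: real_le_enatI)
qed simp

section \<open>Monotonicity of asymptotic bounds and conclusion\<close>

lemma enat_le_real_mono: "x \<le> y \<Longrightarrow> enat_le_real y r \<Longrightarrow> enat_le_real x r"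
  by (cases x; cases y) (auto simp: enat_le_real_def)

lemma real_le_enat_mono: "x \<le> y \<Longrightarrow> real_le_enat r x \<Longrightarrow> real_le_enat r y"
  by (cases x; cases y) (auto simp: real_le_enat_def)

lemma bigO_cost_mono: "(\<And>n. c n \<le> c' n) \<Longrightarrow> bigO_cost c' f \<Longrightarrow> bigO_cost c f"
  unfolding bigO_cost_def by (meson enat_le_real_mono)

lemma bigOmega_cost_mono: "(\<And>n. c n \<le> c' n) \<Longrightarrow> bigOmega_cost c f \<Longrightarrow> bigOmega_cost c' f"
  unfolding bigOmega_cost_def by (meson real_le_enat_mono)

theorem mainTheorem3:
  fixes \<Delta> :: nat and \<alpha> :: real
  assumes "\<Delta> \<ge> 3" and "\<alpha> \<ge> 1"
  shows "R_DIST_Theta \<Delta> \<alpha> (\<lambda>n. ln (real n)) \<and>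
         D_DIST_Theta \<Delta> \<alpha> (\<lambda>n. ln (real n)) \<and>
         R_VOL_Theta \<Delta> \<alpha> (\<lambda>n. ln (real n)) \<and>
         D_VOL_Theta \<Delta> \<alpha> (\<lambda>n. real n)"
  unfolding complexity_Theta_def
proof (intro conjI allI impI)
  show "\<exists>A. R_solves \<Delta> \<alpha> A \<and> bigO_cost (alg_cost dist_exec (R_inst \<Delta> \<alpha>) A) (\<lambda>n. ln (real n))"
    using R_solves_walk_alg bigO_cost_mono[OF R_dist_le_vol R_vol_upper] by blast
  show "\<exists>A. R_solves \<Delta> \<alpha> A \<and> bigO_cost (alg_cost vol_exec (R_inst \<Delta> \<alpha>) A) (\<lambda>n. ln (real n))"
    using R_solves_walk_alg R_vol_upper by blast
  show "\<exists>A. D_solves \<Delta> \<alpha> A \<and> bigO_cost (alg_cost dist_exec (D_inst \<Delta> \<alpha>) A) (\<lambda>n. ln (real n))"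
    using D_solves_nearest_alg D_dist_upper by blast
  show "\<exists>A. D_solves \<Delta> \<alpha> A \<and> bigO_cost (alg_cost vol_exec (D_inst \<Delta> \<alpha>) A) (\<lambda>n. real n)"
    using D_solves_nearest_alg D_vol_upper by blast
next
  fix A :: "(tlab \<times> (nat \<Rightarrow> bool), color) alg" assume A: "R_solves \<Delta> \<alpha> A"
  show dist: "bigOmega_cost (alg_cost dist_exec (R_inst \<Delta> \<alpha>) A) (\<lambda>n. ln (real n))"
    by (rule R_dist_lower[OF assms A])
  show "bigOmega_cost (alg_cost vol_exec (R_inst \<Delta> \<alpha>) A) (\<lambda>n. ln (real n))"
    by (rule bigOmega_cost_mono[OF R_dist_le_vol dist])
next
  fix A :: "(tlab, color) alg" assume A: "D_solves \<Delta> \<alpha> A"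
  show "bigOmega_cost (alg_cost dist_exec (D_inst \<Delta> \<alpha>) A) (\<lambda>n. ln (real n))"
    by (rule D_dist_lower[OF assms A])
  show "bigOmega_cost (alg_cost vol_exec (D_inst \<Delta> \<alpha>) A) (\<lambda>n. real n)"
    by (rule D_vol_lower[OF assms A])
qed

end
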